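(* Let the behavioural policy $\pi_B$ be sufficiently exploratory, such that the induced Markov chain is ergodic. Then soft Q-learning, as described in the context and with suitably chosen step sizes $\{\alpha_t\}_{t\ge0}$ (not depending on $\delta$), converges: the policy $\pi^o_{x,\xi}$ it returns after $T$ iterations satisfies $$\mathbb{E}_o\left[\|\pi^*_{x,\xi}-\pi^o_{x,\xi}\|_\infty^2\right]\le\delta^2,\qquad\text{where } T=\mathcal{O}\left(\frac{\log(1/\delta)}{\delta^2}\right).$$
   Context: Setting. $\mathcal M_{x,\xi}=(\mathcal S,\mathcal A,r,P,\mu,\gamma)$ is a Markov decision process (depending on parameters $x,\xi$, suppressed in $r=r_{x,\xi}$, $P=P_{x,\xi}$, $\mu=\mu_{x,\xi}$) with finite state space $\mathcal S$, finite action space $\mathcal A$, reward bounded by $|r(s,a)|<\overline R$ uniformly in $x,\xi,s,a$, transition kernel $P(s';s,a)$, initial distribution $\mu$ and discount factor $\gamma\in(0,1)$. Fix $\lambda>0$. A policy $\pi$ assigns to each state $s$ a distribution $\pi(\cdot;s)$ on $\mathcal A$; $H(\pi;s)=-\sum_a\pi(a;s)\log\pi(a;s)$. $\pi^*_{x,\xi}$ is the optimal policy for the entropy-regularized objective $\mathbb{E}[\sum_{t\ge0}\gamma^t(r(s_t,a_t)+\lambda H(\pi;s_t))]$ ($s_0\sim\mu$, $a_t\sim\pi(\cdot;s_t)$, $s_{t+1}\sim P(\cdot;s_t,a_t)$), given by $\pi^*_{x,\xi}(a;s)\propto\exp(Q^*_\lambda(s,a)/\lambda)$ with $Q^*_\lambda$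 the optimal regularized Q-function. $\|\pi_1-\pi_2\|_\infty=\max_{s,a}|\pi_1(a;s)-\pi_2(a;s)|$. Soft Q-learning with behavioural policy $\pi_B$ and step sizes $\{\alpha_t\}_{t\ge0}$. Start with $Q=0$ and some state $s_0$. At step $t$ sample $a\sim\pi_B(\cdot;s_t)$, observe $r(s_t,a)$ and the next state $s_{t+1}\sim P(\cdot;s_t,a)$, and update only the entry $$Q(s_t,a)\leftarrow Q(s_t,a)+\alpha_t\Bigl(r(s_t,a)+\gamma\lambda\log\sum_{a'\in\mathcal A}\exp\bigl(Q(s_{t+1},a')/\lambda\bigr)-Q(s_t,a)\Bigr).$$ After $T$ steps return $\pi^o_{x,\xi}(a;s)=\exp(Q(s,a)/\lambda)/\sum_{a'}\exp(Q(s,a')/\lambda)$. The induced Markov chain is the chain of state-action pairs generated by $\pi_B$ (ergodic, with stationary distribution positive on $\mathcal S\times\mathcal A$). $\mathbb{E}_o$ is the expectation over the randomness of the algorithm. $\mathcal{O}(\cdot)$ is as $\delta\to0$, with constants independent of $\delta$. *)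

theory Defs
  imports "HOL-Probability.Probability" "HOL-Library.Landau_Symbols"
begin

section \<open>Finite Markov chains\<close>

definition n_step :: "('z \<Rightarrow> 'z pmf) \<Rightarrow> nat \<Rightarrow> 'z \<Rightarrow> 'z pmf" where
  "n_step K n z = ((\<lambda>p. bind_pmf p K) ^^ n) (return_pmf z)"

definition irreducible_chain :: "('z \<Rightarrow> 'z pmf) \<Rightarrow> bool" where
  "irreducible_chain K \<longleftrightarrow> (\<forall>z z'. \<exists>n. pmf (n_step K n z) z' > 0)"

definition aperiodic_chain :: "('z \<Rightarrow> 'z pmf) \<Rightarrow> bool" where
  "aperiodic_chain K \<longleftrightarrow> (\<forall>z. Gcd {n. n > 0 \<and> pmf (n_step K n z) z > 0} = 1)"

text \<open>On a finite type positive recurrence is automatic, so it is not required separately.\<close>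

definition ergodic_chain :: "('z::finite \<Rightarrow> 'z pmf) \<Rightarrow> bool" where
  "ergodic_chain K \<longleftrightarrow> irreducible_chain K \<and> aperiodic_chain K"

definition stationary_pmf :: "('z \<Rightarrow> 'z pmf) \<Rightarrow> 'z pmf \<Rightarrow> bool" where
  "stationary_pmf K \<nu> \<longleftrightarrow> bind_pmf \<nu> K = \<nu>"


section \<open>The law of the whole trajectory of a Markov chain\<close>

definition chain_kernel :: "'z pmf \<Rightarrow> ('z \<Rightarrow> 'z pmf) \<Rightarrow> nat \<Rightarrow> (nat \<Rightarrow> 'z) \<Rightarrow> 'z measure" where
  "chain_kernel \<iota> K n \<omega> = measure_pmf (if n = 0 then \<iota> else K (\<omega> (n - 1)))"

text \<open>
  The measure on infinite sequences given by the Ionescu-Tulcea theorem for the initial law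
  \<open>\<iota>\<close> and the kernel \<open>K\<close>; it is characterised by \<open>emeasure_chain_law_cylinder\<close> below.
\<close>

definition chain_law :: "'z pmf \<Rightarrow> ('z \<Rightarrow> 'z pmf) \<Rightarrow> (nat \<Rightarrow> 'z) measure" where
  "chain_law \<iota> K =
     projective_family.lim UNIV
       (Ionescu_Tulcea.CI (chain_kernel \<iota> K) (\<lambda>_. count_space UNIV)) (\<lambda>_. count_space UNIV)"

lemma Ionescu_Tulcea_chain_kernel:
  fixes \<iota> :: "'z::countable pmf"
  shows "Ionescu_Tulcea (chain_kernel \<iota> K) (\<lambda>_. count_space UNIV)"
proof (rule Ionescu_Tulcea.intro)
  fix i :: nat
  let ?A = "PiM {0..<i} (\<lambda>_. count_space UNIV) :: (nat \<Rightarrow> 'z) measure"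
  show "chain_kernel \<iota> K i \<in> measurable ?A (subprob_algebra (count_space UNIV))"
  proof (cases "i = 0")
    case True
    have "measure_pmf \<iota> \<in> space (subprob_algebra (count_space UNIV))"
      by (rule measure_pmf_in_subprob_algebra)
    then show ?thesis using True by (simp add: chain_kernel_def[abs_def])
  next
    case False
    have 1: "(\<lambda>\<omega>. \<omega> (i - 1)) \<in> measurable ?A (count_space UNIV)"
      using False by (intro measurable_component_singleton) auto
    have 2: "(\<lambda>z. measure_pmf (K z)) \<in> measurable (count_space UNIV) (subprob_algebra (count_space UNIV))"
      by (auto intro: measure_pmf_in_subprob_algebra)
    show ?thesis using measurable_compose[OF 1 2] False by (simp add: chain_kernel_def[abs_def])
  qed
next
  fix i :: nat and x :: "nat \<Rightarrow> 'z"
  show "prob_space (chain_kernel \<iota> K i x)"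
    by (simp add: chain_kernel_def measure_pmf.prob_space_axioms)
qed

lemma prob_space_chain_law:
  fixes \<iota> :: "'z::countable pmf"
  shows "prob_space (chain_law \<iota> K)"
proof -
  interpret Ionescu_Tulcea "chain_kernel \<iota> K" "\<lambda>_. count_space UNIV"
    by (rule Ionescu_Tulcea_chain_kernel)
  show ?thesis
  proof
    have X: "space (PiM {} (\<lambda>_::nat. count_space (UNIV :: 'z set))) \<in> sets (PiM {} (\<lambda>_. count_space UNIV))"
      by (rule sets.top)
    have "prob_space (CI {})"
      by (rule PF.prob_space_P) auto
    then have "emeasure (CI {}) (space (CI {})) = 1"
      by (rule prob_space.emeasure_space_1)
    moreover have "space (CI {}) = space (PiM {} (\<lambda>_::nat. count_space (UNIV :: 'z set)))"
      by (rule PF.space_P) auto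
    moreover have "PF.emb UNIV {} (space (PiM {} (\<lambda>_::nat. count_space (UNIV :: 'z set)))) = space PF.lim"
      by (auto simp: prod_emb_def space_PiM)
    ultimately show "emeasure (chain_law \<iota> K) (space (chain_law \<iota> K)) = 1"
      unfolding chain_law_def using lim[OF finite.emptyI X] by simp
  qed
qed

lemma emeasure_chain_law_cylinder:
  fixes \<iota> :: "'z::countable pmf"
  shows "emeasure (chain_law \<iota> K) {\<omega>. \<forall>i\<le>n. \<omega> i = z i} =
           ennreal (pmf \<iota> (z 0) * (\<Prod>i<n. pmf (K (z i)) (z (Suc i))))"
proof -
  interpret Ionescu_Tulcea "chain_kernel \<iota> K" "\<lambda>_. count_space UNIV"
    by (rule Ionescu_Tulcea_chain_kernel)
  let ?M = "\<lambda>_::nat. count_space (UNIV :: 'z set)"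
  let ?X = "\<lambda>n. {restrict z {0..<n}}"
  have X: "?X n \<in> sets (PiM {0..<n} ?M)" for n
  proof -
    have "(PiE {0..<n} (\<lambda>i. {z i})) \<in> sets (PiM {0..<n} ?M)"
      by (intro sets_PiM_I_finite) auto
    also have "PiE {0..<n} (\<lambda>i. {z i}) = ?X n"
      by (auto simp: PiE_iff fun_eq_iff restrict_def extensional_def)
    finally show ?thesis .
  qed
  have sp: "restrict z {0..<n} \<in> space (PiM {0..<n} ?M)" for n
    by (auto simp: space_PiM)
  have step: "emeasure (C 0 (Suc n) (\<lambda>_. undefined)) (?X (Suc n)) =
      emeasure (C 0 n (\<lambda>_. undefined)) (?X n) * emeasure (chain_kernel \<iota> K n z) {z n}" for n
  proof -
    let ?C = "C 0 n (\<lambda>_. undefined)"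
    have u: "(\<lambda>_. undefined) \<in> space (PiM {0..<0} ?M)" by (auto simp: space_PiM)
    have sC: "sets ?C = sets (PiM {0..<n} ?M)" "space ?C = space (PiM {0..<n} ?M)"
      using sets_C[OF u, of n] space_C[OF u, of n] by simp_all
    have m: "eP n \<in> measurable ?C (subprob_algebra (PiM {0..<Suc n} ?M))"
      using measurable_eP[of n] by (simp add: measurable_cong_sets[OF sC(1) refl])
    have ne: "space ?C \<noteq> {}" using sC sp by auto
    have "emeasure (?C \<bind> eP n) (?X (Suc n)) = (\<integral>\<^sup>+\<omega>. emeasure (eP n \<omega>) (?X (Suc n)) \<partial>?C)"
      by (rule emeasure_bind[OF ne m X])
    also have "\<dots> = (\<integral>\<^sup>+\<omega>. emeasure (chain_kernel \<iota> K n z) {z n} * indicator (?X n) \<omega> \<partial>?C)"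
    proof (rule nn_integral_cong)
      fix \<omega> assume "\<omega> \<in> space ?C"
      then have w: "\<omega> \<in> space (PiM {0..<n} ?M)" using sC by simp
      have e: "emeasure (eP n \<omega>) (?X (Suc n)) =
          emeasure (chain_kernel \<iota> K n \<omega>) ((\<lambda>x. fun_upd \<omega> n x) -` ?X (Suc n))"
        using emeasure_eP[OF w X[of "Suc n"]] by simp
      show "emeasure (eP n \<omega>) (?X (Suc n)) =
          emeasure (chain_kernel \<iota> K n z) {z n} * indicator (?X n) \<omega>"
      proof (cases "\<omega> = restrict z {0..<n}")
        case True
        have "(\<lambda>x. fun_upd \<omega> n x) -` ?X (Suc n) = {z n}"
          unfolding True by (auto simp: fun_eq_iff restrict_def split: if_splits)
        moreover have "chain_kernel \<iota> K n \<omega> = chain_kernel \<iota> K n z"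
          by (auto simp: chain_kernel_def True)
        ultimately show ?thesis using e True by simp
      next
        case False
        have "(\<lambda>x. fun_upd \<omega> n x) -` ?X (Suc n) = {}"
        proof (rule ccontr)
          assume "(\<lambda>x. fun_upd \<omega> n x) -` ?X (Suc n) \<noteq> {}"
          then obtain x where x: "fun_upd \<omega> n x = restrict z {0..<Suc n}" by auto
          have "\<omega> i = restrict z {0..<n} i" for i
          proof (cases "i < n")
            case True then show ?thesis using fun_cong[OF x, of i] by simp
          next
            case False
            then show ?thesis using w by (auto simp: space_PiM PiE_def extensional_def)
          qed
          then show False using False by blast
        qed
        then show ?thesis using e False by simp
      qed
    qed
    also have "\<dots> = emeasure (chain_kernel \<iota> K n z) {z n} * emeasure ?C (?X n)"
      using X[of n] sC by (subst nn_integral_cmult_indicator) auto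
    finally show ?thesis by (simp add: mult.commute)
  qed
  have ck: "emeasure (chain_kernel \<iota> K 0 z) {z 0} = ennreal (pmf \<iota> (z 0))"
    "emeasure (chain_kernel \<iota> K (Suc n) z) {z (Suc n)} = ennreal (pmf (K (z n)) (z (Suc n)))" for n
    by (simp_all add: chain_kernel_def emeasure_pmf_single)
  have main: "emeasure (C 0 (Suc n) (\<lambda>_. undefined)) (?X (Suc n)) =
      ennreal (pmf \<iota> (z 0) * (\<Prod>i<n. pmf (K (z i)) (z (Suc i))))"
  proof (induction n)
    case 0
    have "emeasure (C 0 0 (\<lambda>_. undefined)) (?X 0) = 1"
      using X[of 0] by (simp add: restrict_def)
    then show ?case
      unfolding step[of 0] ck by simp
  next
    case (Suc n)
    show ?case
      unfolding step[of "Suc n"] Suc ck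
      by (simp add: ennreal_mult prod_nonneg mult.assoc)
  qed
  have cyl: "{\<omega>. \<forall>i\<le>n. \<omega> i = z i} = PF.emb UNIV {0..<Suc n} (?X (Suc n))"
    by (auto simp: prod_emb_def fun_eq_iff restrict_def less_Suc_eq_le split: if_splits)
  have u2: "{0..<Suc n} \<subseteq> {0..<Suc n}" by simp
  have "emeasure (chain_law \<iota> K) {\<omega>. \<forall>i\<le>n. \<omega> i = z i} = emeasure (CI {0..<Suc n}) (?X (Suc n))"
    unfolding chain_law_def cyl using X by (intro lim) auto
  also have "\<dots> = emeasure (C 0 (Suc n) (\<lambda>_. undefined)) (?X (Suc n))"
  proof -
    have "PF.emb {0..<Suc n} {0..<Suc n} (?X (Suc n)) = ?X (Suc n)"
      using sp[of "Suc n"] by (intro prod_emb_id) (auto simp: space_PiM)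
    then show ?thesis using emeasure_CI[OF u2 X] by simp
  qed
  finally show ?thesis using main by simp
qed


section \<open>Entropy-regularised Markov decision processes\<close>

text \<open>
  A policy is a function \<open>\<pi> :: 's \<Rightarrow> 'a pmf\<close>, the transition kernel is
  \<open>P :: 's \<Rightarrow> 'a \<Rightarrow> 's pmf\<close>; \<open>pmf (\<pi> s) a\<close> is \<open>\<pi>(a; s)\<close> and \<open>pmf (P s a) s'\<close> is \<open>P(s'; s, a)\<close>.
\<close>

definition state_action_kernel ::
    "('s \<Rightarrow> 'a \<Rightarrow> 's pmf) \<Rightarrow> ('s \<Rightarrow> 'a pmf) \<Rightarrow> 's \<times> 'a \<Rightarrow> ('s \<times> 'a) pmf" where
  "state_action_kernel P \<pi> = (\<lambda>(s, a). bind_pmf (P s a) (\<lambda>s'. map_pmf (Pair s') (\<pi> s')))"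

definition mdp_law ::
    "('s \<Rightarrow> 'a \<Rightarrow> 's pmf) \<Rightarrow> 's pmf \<Rightarrow> ('s \<Rightarrow> 'a pmf) \<Rightarrow> (nat \<Rightarrow> 's \<times> 'a) measure" where
  "mdp_law P \<mu> \<pi> =
     chain_law (bind_pmf \<mu> (\<lambda>s. map_pmf (Pair s) (\<pi> s))) (state_action_kernel P \<pi>)"

text \<open>Since \<open>ln 0 = 0\<close>, actions of probability zero contribute nothing, as usual.\<close>

definition policy_entropy :: "('s \<Rightarrow> 'a::finite pmf) \<Rightarrow> 's \<Rightarrow> real" where
  "policy_entropy \<pi> s = - (\<Sum>a\<in>UNIV. pmf (\<pi> s) a * ln (pmf (\<pi> s) a))"

definition regularized_return ::
    "('s \<Rightarrow> 'a \<Rightarrow> real) \<Rightarrow> ('s \<Rightarrow> 'a \<Rightarrow> 's pmf) \<Rightarrow> real \<Rightarrow> real \<Rightarrow> 's pmf \<Rightarrow> ('s \<Rightarrow> 'a::finite pmf) \<Rightarrow> real"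
  where
  "regularized_return r P \<gamma> lam \<mu> \<pi> =
     (\<integral>\<omega>. (\<Sum>t. \<gamma> ^ t * (r (fst (\<omega> t)) (snd (\<omega> t)) + lam * policy_entropy \<pi> (fst (\<omega> t)))) \<partial>mdp_law P \<mu> \<pi>)"

definition regularized_optimal ::
    "('s \<Rightarrow> 'a \<Rightarrow> real) \<Rightarrow> ('s \<Rightarrow> 'a \<Rightarrow> 's pmf) \<Rightarrow> real \<Rightarrow> real \<Rightarrow> 's pmf \<Rightarrow> ('s \<Rightarrow> 'a::finite pmf) \<Rightarrow> bool"
  where
  "regularized_optimal r P \<gamma> lam \<mu> \<pi> \<longleftrightarrow>
     (\<forall>\<pi>'. regularized_return r P \<gamma> lam \<mu> \<pi>' \<le> regularized_return r P \<gamma> lam \<mu> \<pi>)"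

text \<open>
  The entropy of the policy is not counted at the initial time, where the action is prescribed;
  this is the convention under which the optimal policy is the softmax of \<open>Q / lam\<close>.
\<close>

definition soft_Q ::
    "('s::finite \<Rightarrow> 'a \<Rightarrow> real) \<Rightarrow> ('s \<Rightarrow> 'a \<Rightarrow> 's pmf) \<Rightarrow> real \<Rightarrow> real \<Rightarrow> ('s \<Rightarrow> 'a::finite pmf) \<Rightarrow> 's \<Rightarrow> 'a \<Rightarrow> real"
  where
  "soft_Q r P \<gamma> lam \<pi> s a =
     r s a + \<gamma> * (\<Sum>s'\<in>UNIV. pmf (P s a) s' * regularized_return r P \<gamma> lam (return_pmf s') \<pi>)"

definition optimal_soft_Q ::
    "('s::finite \<Rightarrow> 'a::finite \<Rightarrow> real) \<Rightarrow> ('s \<Rightarrow> 'a \<Rightarrow> 's pmf) \<Rightarrow> real \<Rightarrow> real \<Rightarrow> 's \<Rightarrow> 'a \<Rightarrow> real"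
  where
  "optimal_soft_Q r P \<gamma> lam s a = (SUP \<pi>. soft_Q r P \<gamma> lam \<pi> s a)"

definition softmax_policy :: "real \<Rightarrow> ('s \<Rightarrow> 'a::finite \<Rightarrow> real) \<Rightarrow> 's \<Rightarrow> 'a pmf" where
  "softmax_policy lam Q s =
     embed_pmf (\<lambda>a. exp (Q s a / lam) / (\<Sum>a'\<in>UNIV. exp (Q s a' / lam)))"

lemma pmf_softmax_policy:
  "pmf (softmax_policy lam Q s) a = exp (Q s a / lam) / (\<Sum>a'\<in>UNIV. exp (Q s a' / lam))"
proof -
  let ?S = "\<Sum>a'\<in>UNIV. exp (Q s a' / lam)"
  have S: "?S > 0" by (intro sum_pos) auto
  show ?thesis
    unfolding softmax_policy_def
  proof (rule pmf_embed_pmf)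
    show "0 \<le> exp (Q s x / lam) / ?S" for x using S by simp
    have "(\<integral>\<^sup>+x. ennreal (exp (Q s x / lam) / ?S) \<partial>count_space UNIV) =
        ennreal (\<Sum>x\<in>UNIV. exp (Q s x / lam) / ?S)"
      using S by (simp add: nn_integral_count_space_finite sum_ennreal)
    then show "(\<integral>\<^sup>+x. ennreal (exp (Q s x / lam) / ?S) \<partial>count_space UNIV) = 1"
      using S by (simp add: sum_divide_distrib[symmetric])
  qed
qed

definition policy_dist :: "('s::finite \<Rightarrow> 'a::finite pmf) \<Rightarrow> ('s \<Rightarrow> 'a pmf) \<Rightarrow> real" where
  "policy_dist \<pi>1 \<pi>2 = (MAX (s, a)\<in>UNIV. \<bar>pmf (\<pi>1 s) a - pmf (\<pi>2 s) a\<bar>)"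


section \<open>Soft Q-learning\<close>

definition soft_Q_update ::
    "('s \<Rightarrow> 'a \<Rightarrow> real) \<Rightarrow> real \<Rightarrow> real \<Rightarrow> real \<Rightarrow> 's \<Rightarrow> 'a \<Rightarrow> 's \<Rightarrow> ('s \<Rightarrow> 'a::finite \<Rightarrow> real) \<Rightarrow> 's \<Rightarrow> 'a \<Rightarrow> real"
  where
  "soft_Q_update r \<gamma> lam step s a s' Q =
     (\<lambda>u b. if u = s \<and> b = a
        then Q s a + step * (r s a + \<gamma> * lam * ln (\<Sum>a'\<in>UNIV. exp (Q s' a' / lam)) - Q s a)
        else Q u b)"

text \<open>
  Joint law of the Q-table and the current state after the given number of iterations;
  \<open>\<alpha>\<close> is the step size sequence, \<open>\<pi>B\<close> the behavioural policy and \<open>s0\<close> the starting state.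
\<close>

primrec soft_Q_learning ::
    "('s \<Rightarrow> 'a \<Rightarrow> real) \<Rightarrow> ('s \<Rightarrow> 'a \<Rightarrow> 's pmf) \<Rightarrow> real \<Rightarrow> real \<Rightarrow> ('s \<Rightarrow> 'a::finite pmf) \<Rightarrow> 's \<Rightarrow>
     (nat \<Rightarrow> real) \<Rightarrow> nat \<Rightarrow> (('s \<Rightarrow> 'a \<Rightarrow> real) \<times> 's) pmf"
  where
  "soft_Q_learning r P \<gamma> lam \<pi>B s0 \<alpha> 0 = return_pmf (\<lambda>_ _. 0, s0)"
| "soft_Q_learning r P \<gamma> lam \<pi>B s0 \<alpha> (Suc t) =
     bind_pmf (soft_Q_learning r P \<gamma> lam \<pi>B s0 \<alpha> t) (\<lambda>(Q, s).
       bind_pmf (\<pi>B s) (\<lambda>a.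
         map_pmf (\<lambda>s'. (soft_Q_update r \<gamma> lam (\<alpha> t) s a s' Q, s')) (P s a)))"

definition soft_Q_learning_policy ::
    "('s \<Rightarrow> 'a \<Rightarrow> real) \<Rightarrow> ('s \<Rightarrow> 'a \<Rightarrow> 's pmf) \<Rightarrow> real \<Rightarrow> real \<Rightarrow> ('s \<Rightarrow> 'a::finite pmf) \<Rightarrow> 's \<Rightarrow>
     (nat \<Rightarrow> real) \<Rightarrow> nat \<Rightarrow> ('s \<Rightarrow> 'a pmf) pmf"
  where
  "soft_Q_learning_policy r P \<gamma> lam \<pi>B s0 \<alpha> T =
     map_pmf (\<lambda>(Q, s). softmax_policy lam Q) (soft_Q_learning r P \<gamma> lam \<pi>B s0 \<alpha> T)"

end

theory Submission
  imports Defs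
begin

text \<open>
  Write \<open>\<Delta>\<close> for the difference between the current table and the optimal table \<open>Q*\<close>. Two facts
  about the log-sum-exp function carry the statement. It is 1-Lipschitz for the supremum norm, so
  the soft Bellman operator is a \<open>\<gamma>\<close>-contraction for that norm; and by Gibbs' variational principle
  its fixed point is the supremum of the Q-functions of all policies, hence \<open>Q*\<close>
  (\<open>soft_bellman_optimal_soft_Q\<close>). Given the current state-action pair \<open>z\<close>, one iteration moves
  the entry \<open>\<Delta> z\<close> by the step size times the temporal difference error, whose conditional mean
  is \<open>G z - \<Delta> z\<close> with \<open>\<bar>G z\<bar> \<le> \<gamma> max \<bar>\<Delta>\<bar>\<close>. Two obstacles remain: the supremum norm is not smooth,
  and the entry that is updated is chosen by a Markov chain instead of being drawn from \<open>\<nu>\<close>.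

  For the first, the supremum norm is replaced by a sum \<open>S\<close> of even powers \<open>\<Delta> z ^ p\<close>. Young's
  inequality turns the contraction into an inequality that is linear in these powers
  (\<open>td_drift\<close>). With the weights \<open>1 / \<nu> z\<close>, which compensate the visiting frequencies, the
  stationary mean of the drift is at most \<open>- (p - \<gamma> (p - 1) - \<gamma> d) S\<close>, where \<open>d\<close> is the number of
  state-action pairs; it is negative as soon as \<open>p\<close> is large.

  For the second, linearity pays off: each power \<open>\<Delta> z ^ p\<close> enters the drift with a coefficient that
  depends on the state of the chain alone. Solving the Poisson equation for these finitely many
  coefficient functions (\<open>poisson_equation\<close>) and adding the step size times the solutions to the
  weights replaces the drift by its stationary mean, up to terms of second order in the step
  size (\<open>correctors_exist\<close>).

  The second order terms \<open>\<alpha>^2 \<Delta> z ^ (p - 2)\<close> are absorbed by the drift at the price of a term of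
  order \<open>\<alpha> ^ (p / 2 + 1)\<close> (\<open>noise_absorption\<close>). The mean \<open>v\<close> of the resulting Lyapunov function
  therefore obeys \<open>v (t + 1) \<le> (1 - \<kappa> \<alpha>) v t + C \<alpha> ^ (p / 2 + 1)\<close>, and the step sizes
  \<open>\<alpha> = a / (t + b)\<close> with a large constant \<open>a\<close> give \<open>v t = O(t ^ (- p / 2))\<close>
  (\<open>harmonic_step_decay\<close>). This is the mean of a power \<open>p\<close>, so the mean of \<open>max \<bar>\<Delta>\<bar>^2\<close> is \<open>O(1 / t)\<close>.
  The softmax policy depends on the table in a Lipschitz way, so its squared error has the same
  rate, and about \<open>C / \<delta>^2\<close> iterations suffice.
\<close>

section \<open>Log-sum-exp and softmax policies\<close>

definition soft_maximum :: "real \<Rightarrow> ('a::finite \<Rightarrow> real) \<Rightarrow> real" where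
  "soft_maximum lam x = lam * ln (\<Sum>a\<in>UNIV. exp (x a / lam))"

lemma sum_exp_pos: "0 < (\<Sum>a\<in>(UNIV::'a::finite set). exp (x a / lam :: real))"
  by (intro sum_pos) auto

lemma soft_maximum_le_add:
  assumes lam: "0 < lam" and le: "\<And>a. x a \<le> y a + c"
  shows "soft_maximum lam x \<le> soft_maximum lam y + c"
proof -
  have "(\<Sum>a\<in>UNIV. exp (x a / lam)) \<le> (\<Sum>a\<in>UNIV. exp (c / lam) * exp (y a / lam))"
  proof (intro sum_mono)
    fix a
    have "x a / lam \<le> c / lam + y a / lam"
      using le[of a] lam by (simp add: field_simps)
    then show "exp (x a / lam) \<le> exp (c / lam) * exp (y a / lam)"
      by (simp flip: exp_add)
  qed
  also have "\<dots> = exp (c / lam) * (\<Sum>a\<in>UNIV. exp (y a / lam))"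
    by (simp add: sum_distrib_left)
  finally have "ln (\<Sum>a\<in>UNIV. exp (x a / lam)) \<le> ln (exp (c / lam) * (\<Sum>a\<in>UNIV. exp (y a / lam)))"
    using sum_exp_pos[of x lam] by (subst ln_le_cancel_iff) auto
  also have "\<dots> = c / lam + ln (\<Sum>a\<in>UNIV. exp (y a / lam))"
    using sum_exp_pos[of y lam] by (simp add: ln_mult)
  finally show ?thesis
    using lam by (simp add: soft_maximum_def field_simps)
qed

lemma soft_maximum_lipschitz:
  assumes "0 < lam" and "\<And>a. \<bar>x a - y a\<bar> \<le> c"
  shows "\<bar>soft_maximum lam x - soft_maximum lam y\<bar> \<le> c"
proof -
  have "x a \<le> y a + c" "y a \<le> x a + c" for a
    using assms(2)[of a] by auto
  then show ?thesis
    using soft_maximum_le_add[OF assms(1), of x y c] soft_maximum_le_add[OF assms(1), of y x c] by auto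
qed

lemma soft_maximum_bound:
  fixes x :: "'a::finite \<Rightarrow> real"
  assumes "0 < lam" and "\<And>a. \<bar>x a\<bar> \<le> B"
  shows "\<bar>soft_maximum lam x\<bar> \<le> B + lam * ln (real CARD('a))"
proof -
  have "\<bar>soft_maximum lam x - soft_maximum lam (\<lambda>_::'a. 0)\<bar> \<le> B"
    using assms by (intro soft_maximum_lipschitz) auto
  moreover have "soft_maximum lam (\<lambda>_::'a. 0) = lam * ln (real CARD('a))"
    by (simp add: soft_maximum_def)
  moreover have "0 \<le> lam * ln (real CARD('a))"
    using assms(1) by (simp add: Suc_leI)
  ultimately show ?thesis by linarith
qed

text \<open>
  The log-probability of an action is \<open>(Q s a - soft_maximum lam (Q s)) / lam\<close>. Both terms move by
  at most \<open>c\<close>, so probabilities change at most by the factor \<open>exp (2 * c / lam)\<close>.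
\<close>

lemma softmax_policy_dist_le:
  fixes Q Q' :: "'s::finite \<Rightarrow> 'a::finite \<Rightarrow> real"
  assumes lam: "0 < lam" and le: "\<And>s a. \<bar>Q s a - Q' s a\<bar> \<le> c"
  shows "policy_dist (softmax_policy lam Q) (softmax_policy lam Q') \<le> 2 * c / lam"
proof -
  have one_side: "pmf (softmax_policy lam R s) a - pmf (softmax_policy lam R' s) a \<le> 2 * c / lam"
    if le: "\<And>s a. \<bar>R s a - R' s a\<bar> \<le> c" for R R' :: "'s \<Rightarrow> 'a \<Rightarrow> real" and s a
  proof -
    let ?p = "pmf (softmax_policy lam R s) a" and ?p' = "pmf (softmax_policy lam R' s) a"
    have logp: "pmf (softmax_policy lam R s) a = exp ((R s a - soft_maximum lam (R s)) / lam)" for R :: "'s \<Rightarrow> 'a \<Rightarrow> real"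
      using lam sum_exp_pos[of "R s" lam]
      by (simp add: pmf_softmax_policy soft_maximum_def diff_divide_distrib exp_diff)
    have "(R s a - soft_maximum lam (R s)) - 2 * c \<le> R' s a - soft_maximum lam (R' s)"
      using le[of s a] soft_maximum_lipschitz[of lam "R s" "R' s" c, OF lam le] by (auto simp: abs_le_iff)
    then have "(R s a - soft_maximum lam (R s)) / lam - 2 * c / lam \<le> (R' s a - soft_maximum lam (R' s)) / lam"
      using lam by (auto dest: divide_right_mono[where c = lam] simp: diff_divide_distrib)
    then have "exp (- (2 * c / lam)) * ?p \<le> ?p'"
      unfolding logp by (simp flip: exp_add)
    moreover have "(1 - 2 * c / lam) * ?p \<le> exp (- (2 * c / lam)) * ?p"
      using exp_ge_add_one_self[of "- (2 * c / lam)"] by (intro mult_right_mono) auto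
    moreover have "0 \<le> c"
      using le[of s a] by linarith
    then have "2 * c / lam * ?p \<le> 2 * c / lam * 1"
      using lam by (intro mult_left_mono) (auto simp: pmf_le_1)
    ultimately show ?thesis by (simp add: algebra_simps)
  qed
  have "\<bar>pmf (softmax_policy lam Q s) a - pmf (softmax_policy lam Q' s) a\<bar> \<le> 2 * c / lam" for s a
    using one_side[of Q Q' s a] one_side[of Q' Q s a] le by (auto simp: abs_minus_commute abs_le_iff)
  then show ?thesis
    unfolding policy_dist_def by (subst Max_le_iff) auto
qed

lemma policy_dist_nonneg:
  fixes \<pi>1 \<pi>2 :: "'s::finite \<Rightarrow> 'a::finite pmf"
  shows "0 \<le> policy_dist \<pi>1 \<pi>2"
proof -
  have "\<bar>pmf (\<pi>1 s) a - pmf (\<pi>2 s) a\<bar> \<le> policy_dist \<pi>1 \<pi>2" for s a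
    unfolding policy_dist_def by (rule Max_ge) auto
  then show ?thesis using abs_ge_zero order_trans by blast
qed

lemma sum_pmf_UNIV: "(\<Sum>x\<in>UNIV. pmf p x) = 1" for p :: "'z::finite pmf"
  by (rule sum_pmf_eq_1) auto

lemma pmf_mean_mono:
  fixes p :: "'z::finite pmf"
  assumes "\<And>z. f z \<le> g z"
  shows "(\<Sum>z\<in>UNIV. pmf p z * f z) \<le> (\<Sum>z\<in>UNIV. pmf p z * g z)"
  using assms by (intro sum_mono mult_left_mono) auto

lemma pmf_mean_const: "(\<Sum>z\<in>UNIV. pmf p z * c) = c" for p :: "'z::finite pmf"
  by (simp add: sum_pmf_UNIV flip: sum_distrib_right)

lemma pmf_mean_abs_le:
  fixes p :: "'z::finite pmf"
  assumes "\<And>z. \<bar>f z\<bar> \<le> B"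
  shows "\<bar>\<Sum>z\<in>UNIV. pmf p z * f z\<bar> \<le> B"
proof -
  have "f z \<le> B" "- B \<le> f z" for z using assms[of z] by auto
  then show ?thesis
    using pmf_mean_mono[of f "\<lambda>_. B" p] pmf_mean_mono[of "\<lambda>_. - B" f p]
    unfolding pmf_mean_const by (simp add: abs_le_iff)
qed

text \<open>
  Gibbs' variational principle, obtained by averaging \<open>ln u \<le> u - 1\<close> with \<open>u\<close> the ratio between the
  softmax probability and the probability of an action under \<open>p\<close>.
\<close>

lemma gibbs_variational_inequality:
  fixes x :: "'a::finite \<Rightarrow> real"
  assumes lam: "0 < lam"
  shows "(\<Sum>a\<in>UNIV. pmf p a * x a) + lam * policy_entropy (\<lambda>_. p) s \<le> soft_maximum lam x"
proof -
  let ?M = "soft_maximum lam x" and ?Z = "\<Sum>a\<in>UNIV. exp (x a / lam)"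
  have "pmf p a * x a - lam * (pmf p a * ln (pmf p a)) - pmf p a * ?M \<le> lam * (exp (x a / lam) / ?Z - pmf p a)" for a
  proof (cases "pmf p a = 0")
    case True
    then show ?thesis using lam sum_exp_pos[of x lam] by simp
  next
    case False
    then have pos: "0 < pmf p a" by (simp add: pmf_pos)
    let ?u = "exp (x a / lam) / (?Z * pmf p a)"
    have "0 < ?u" using pos sum_exp_pos[of x lam] by simp
    then have "ln ?u \<le> ?u - 1" by (rule ln_le_minus_one)
    moreover have "ln ?u = x a / lam - ?M / lam - ln (pmf p a)"
      using pos sum_exp_pos[of x lam] lam by (simp add: ln_div ln_mult soft_maximum_def)
    ultimately have "lam * pmf p a * (x a / lam - ?M / lam - ln (pmf p a)) \<le> lam * pmf p a * (?u - 1)"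
      using pos lam by (intro mult_left_mono) auto
    moreover have "lam * pmf p a * (?u - 1) = lam * (exp (x a / lam) / ?Z - pmf p a)"
      using pos by (simp add: field_simps)
    moreover have "lam * pmf p a * (x a / lam - ?M / lam - ln (pmf p a))
        = pmf p a * x a - lam * (pmf p a * ln (pmf p a)) - pmf p a * ?M"
      using lam by (simp add: field_simps)
    ultimately show ?thesis by simp
  qed
  then have "(\<Sum>a\<in>UNIV. pmf p a * x a - lam * (pmf p a * ln (pmf p a)) - pmf p a * ?M)
      \<le> (\<Sum>a\<in>UNIV. lam * (exp (x a / lam) / ?Z - pmf p a))"
    by (intro sum_mono)
  also have "\<dots> = 0"
    using sum_exp_pos[of x lam]
    by (simp add: sum_subtractf sum_pmf_UNIV flip: sum_distrib_left sum_divide_distrib)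
  also have "(\<Sum>a\<in>UNIV. pmf p a * x a - lam * (pmf p a * ln (pmf p a)) - pmf p a * ?M)
     = (\<Sum>a\<in>UNIV. pmf p a * x a) + lam * policy_entropy (\<lambda>_. p) s - ?M"
    by (simp add: sum_subtractf policy_entropy_def sum_pmf_UNIV flip: sum_distrib_left sum_distrib_right)
  finally show ?thesis by simp
qed

lemma gibbs_variational_equality:
  fixes Q :: "'s \<Rightarrow> 'a::finite \<Rightarrow> real"
  assumes lam: "0 < lam"
  shows "(\<Sum>a\<in>UNIV. pmf (softmax_policy lam Q s) a * Q s a) + lam * policy_entropy (softmax_policy lam Q) s
    = soft_maximum lam (Q s)"
proof -
  let ?p = "pmf (softmax_policy lam Q s)" and ?M = "soft_maximum lam (Q s)"
  have ln_p: "lam * ln (?p a) = Q s a - ?M" for a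
    using lam sum_exp_pos[of "Q s" lam]
    by (simp add: pmf_softmax_policy soft_maximum_def ln_div algebra_simps)
  have "lam * policy_entropy (softmax_policy lam Q) s = - (\<Sum>a\<in>UNIV. ?p a * (lam * ln (?p a)))"
    by (simp add: policy_entropy_def sum_distrib_left algebra_simps)
  also have "\<dots> = ?M - (\<Sum>a\<in>UNIV. ?p a * Q s a)"
    unfolding ln_p by (simp add: right_diff_distrib sum_subtractf sum_pmf_UNIV flip: sum_distrib_right)
  finally show ?thesis by simp
qed

section \<open>Expectations along a Markov chain\<close>

definition kernel_mean :: "('z::finite \<Rightarrow> 'z pmf) \<Rightarrow> ('z \<Rightarrow> real) \<Rightarrow> 'z \<Rightarrow> real" where
  "kernel_mean K f z = (\<Sum>z'\<in>UNIV. pmf (K z) z' * f z')"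

lemma kernel_mean_abs_le:
  assumes "\<And>z. \<bar>f z\<bar> \<le> B"
  shows "\<bar>kernel_mean K f z\<bar> \<le> B"
  unfolding kernel_mean_def using assms by (rule pmf_mean_abs_le)

lemma funpow_kernel_mean_abs_le:
  assumes "\<And>z. \<bar>f z\<bar> \<le> B"
  shows "\<bar>(kernel_mean K ^^ n) f z\<bar> \<le> B"
proof (induction n arbitrary: z)
  case 0
  then show ?case using assms by simp
next
  case (Suc n)
  then show ?case by (simp add: kernel_mean_abs_le)
qed

lemma sets_chain_law:
  fixes \<iota> :: "'z::countable pmf"
  shows "sets (chain_law \<iota> K) = sets (PiM UNIV (\<lambda>_. count_space UNIV))"
proof -
  interpret Ionescu_Tulcea "chain_kernel \<iota> K" "\<lambda>_. count_space UNIV"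
    by (rule Ionescu_Tulcea_chain_kernel)
  show ?thesis by (simp add: chain_law_def)
qed

lemma measurable_chain_law_component:
  fixes \<iota> :: "'z::countable pmf"
  shows "(\<lambda>\<omega>. f (\<omega> n)) \<in> borel_measurable (chain_law \<iota> K)"
proof -
  have "(\<lambda>\<omega>. \<omega> n) \<in> measurable (chain_law \<iota> K) (count_space UNIV)"
    by (simp add: measurable_cong_sets[OF sets_chain_law refl])
  then show ?thesis by (rule measurable_compose) simp
qed

lemma integrable_chain_law_component:
  fixes \<iota> :: "'z::finite pmf" and f :: "'z \<Rightarrow> real"
  shows "integrable (chain_law \<iota> K) (\<lambda>\<omega>. f (\<omega> n))"
proof -
  interpret prob_space "chain_law \<iota> K" by (rule prob_space_chain_law)
  show ?thesis
    by (rule integrable_const_bound[of _ "Max (range (\<lambda>z. \<bar>f z\<bar>))"])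
      (auto intro: measurable_chain_law_component)
qed

lemma space_chain_law:
  fixes \<iota> :: "'z::countable pmf"
  shows "space (chain_law \<iota> K) = UNIV"
  using sets_eq_imp_space_eq[OF sets_chain_law, of \<iota> K] by (simp add: space_PiM)

lemma cylinder_sets_chain_law [measurable]:
  fixes \<iota> :: "'z::countable pmf"
  shows "{\<omega>. \<forall>i\<le>n. \<omega> i = z i} \<in> sets (chain_law \<iota> K)"
proof -
  have [measurable]: "(\<lambda>\<omega>. \<omega> i) \<in> measurable (chain_law \<iota> K) (count_space UNIV)" for i
    by (simp add: measurable_cong_sets[OF sets_chain_law refl])
  have "{\<omega> \<in> space (chain_law \<iota> K). \<forall>i\<le>n. \<omega> i = z i} \<in> sets (chain_law \<iota> K)"
    by measurable
  then show ?thesis by (simp add: space_chain_law)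
qed

lemma measure_chain_law_cylinder:
  fixes \<iota> :: "'z::countable pmf"
  shows "measure (chain_law \<iota> K) {\<omega>. \<forall>i\<le>n. \<omega> i = z i} =
    pmf \<iota> (z 0) * (\<Prod>i<n. pmf (K (z i)) (z (Suc i)))"
  unfolding measure_def emeasure_chain_law_cylinder by (simp add: prod_nonneg)

text \<open>
  Only the probabilities of cylinders are known, so the trajectories are split according to their
  first \<open>n + 1\<close> states; on each of these finitely many pieces both sides are explicit.
\<close>

lemma chain_law_markov_step:
  fixes \<iota> :: "'z::finite pmf" and f :: "'z \<Rightarrow> real"
  shows "(\<integral>\<omega>. f (\<omega> (Suc n)) \<partial>chain_law \<iota> K) = (\<integral>\<omega>. kernel_mean K f (\<omega> n) \<partial>chain_law \<iota> K)"
proof -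
  let ?M = "chain_law \<iota> K"
  let ?cyl = "\<lambda>n z. {\<omega> :: nat \<Rightarrow> 'z. \<forall>i\<le>n. \<omega> i = z i}"
  let ?paths = "PiE {..n} (\<lambda>_. UNIV :: 'z set)"
  interpret prob_space ?M by (rule prob_space_chain_law)
  have fin: "finite ?paths" by (intro finite_PiE) auto
  have one: "(\<Sum>x\<in>?paths. indicator (?cyl n x) \<omega>) = (1::real)" for \<omega>
  proof -
    have "indicator (?cyl n x) \<omega> = (if x = restrict \<omega> {..n} then 1 else 0 :: real)" if "x \<in> ?paths" for x
      using that by (auto simp: indicator_def fun_eq_iff restrict_def PiE_def extensional_def)
    then have "(\<Sum>x\<in>?paths. indicator (?cyl n x) \<omega>) = (\<Sum>x\<in>?paths. if x = restrict \<omega> {..n} then 1 else 0 :: real)"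
      by (intro sum.cong) auto
    also have "\<dots> = 1" using fin by (subst sum.delta) auto
    finally show ?thesis .
  qed
  have split: "(\<integral>\<omega>. g \<omega> \<partial>?M) = (\<Sum>x\<in>?paths. \<integral>\<omega>. indicator (?cyl n x) \<omega> * g \<omega> \<partial>?M)"
    if "integrable ?M g" for g :: "(nat \<Rightarrow> 'z) \<Rightarrow> real"
  proof -
    have "(\<integral>\<omega>. g \<omega> \<partial>?M) = (\<integral>\<omega>. (\<Sum>x\<in>?paths. indicator (?cyl n x) \<omega> * g \<omega>) \<partial>?M)"
      by (simp add: one flip: sum_distrib_right)
    also have "\<dots> = (\<Sum>x\<in>?paths. \<integral>\<omega>. indicator (?cyl n x) \<omega> * g \<omega> \<partial>?M)"
      using that by (intro Bochner_Integration.integral_sum integrable_real_mult_indicator[unfolded mult.commute[of _ "indicator _ _"]]) auto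
    finally show ?thesis .
  qed
  have path: "(\<integral>\<omega>. indicator (?cyl n x) \<omega> * f (\<omega> (Suc n)) \<partial>?M)
    = (\<integral>\<omega>. indicator (?cyl n x) \<omega> * kernel_mean K f (\<omega> n) \<partial>?M)" for x
  proof -
    have pw: "indicator (?cyl n x) \<omega> * f (\<omega> (Suc n)) =
        (\<Sum>z\<in>UNIV. indicator (?cyl (Suc n) (x(Suc n := z))) \<omega> * f z)" for \<omega>
    proof -
      have "indicator (?cyl (Suc n) (x(Suc n := z))) \<omega> * f z
        = (if \<omega> (Suc n) = z then indicator (?cyl n x) \<omega> * f z else 0)" for z
        by (auto simp: indicator_def le_Suc_eq)
      then show ?thesis by simp
    qed
    have "(\<integral>\<omega>. indicator (?cyl n x) \<omega> * f (\<omega> (Suc n)) \<partial>?M)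
      = (\<Sum>z\<in>UNIV. measure ?M (?cyl (Suc n) (x(Suc n := z))) * f z)"
      unfolding pw by (subst Bochner_Integration.integral_sum) (auto simp: emeasure_eq_measure)
    also have "\<dots> = (\<Sum>z\<in>UNIV. measure ?M (?cyl n x) * (pmf (K (x n)) z * f z))"
      unfolding measure_chain_law_cylinder by (intro sum.cong) (auto simp: mult_ac)
    also have "\<dots> = measure ?M (?cyl n x) * kernel_mean K f (x n)"
      by (simp add: kernel_mean_def sum_distrib_left)
    also have "\<dots> = (\<integral>\<omega>. indicator (?cyl n x) \<omega> * kernel_mean K f (x n) \<partial>?M)"
      by (simp add: emeasure_eq_measure)
    also have "\<dots> = (\<integral>\<omega>. indicator (?cyl n x) \<omega> * kernel_mean K f (\<omega> n) \<partial>?M)"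
      by (intro Bochner_Integration.integral_cong) (auto simp: indicator_def)
    finally show ?thesis .
  qed
  show ?thesis
    by (simp add: split integrable_chain_law_component path)
qed

lemma chain_law_expectation:
  fixes \<iota> :: "'z::finite pmf" and f :: "'z \<Rightarrow> real"
  shows "(\<integral>\<omega>. f (\<omega> n) \<partial>chain_law \<iota> K) = (\<Sum>z\<in>UNIV. pmf \<iota> z * (kernel_mean K ^^ n) f z)"
proof (induction n arbitrary: f)
  case 0
  let ?M = "chain_law \<iota> K"
  interpret prob_space ?M by (rule prob_space_chain_law)
  have m: "{\<omega>. \<omega> 0 = z} \<in> sets ?M" "measure ?M {\<omega>. \<omega> 0 = z} = pmf \<iota> z" for z
    using cylinder_sets_chain_law[of 0 "\<lambda>_. z" \<iota> K] measure_chain_law_cylinder[of \<iota> K 0 "\<lambda>_. z"] by auto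
  have "(\<integral>\<omega>. f (\<omega> 0) \<partial>?M) = (\<integral>\<omega>. (\<Sum>z\<in>UNIV. indicator {\<omega>. \<omega> 0 = z} \<omega> * f z) \<partial>?M)"
  proof (intro Bochner_Integration.integral_cong refl)
    fix \<omega> :: "nat \<Rightarrow> 'z"
    have "indicator {\<omega>. \<omega> 0 = z} \<omega> * f z = (if \<omega> 0 = z then f z else 0)" for z
      by (auto simp: indicator_def)
    then show "f (\<omega> 0) = (\<Sum>z\<in>UNIV. indicator {\<omega>. \<omega> 0 = z} \<omega> * f z)" by simp
  qed
  also have "\<dots> = (\<Sum>z\<in>UNIV. pmf \<iota> z * f z)"
    using m by (subst Bochner_Integration.integral_sum) (auto simp: emeasure_eq_measure)
  finally show ?case by simp
next
  case (Suc n)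
  then show ?case
    by (simp add: chain_law_markov_step funpow_swap1)
qed

definition discounted_value :: "('z::finite \<Rightarrow> 'z pmf) \<Rightarrow> real \<Rightarrow> ('z \<Rightarrow> real) \<Rightarrow> 'z \<Rightarrow> real" where
  "discounted_value K \<gamma> c z = (\<Sum>t. \<gamma> ^ t * (kernel_mean K ^^ t) c z)"

lemma summable_discounted:
  fixes u :: "nat \<Rightarrow> real"
  assumes "0 \<le> \<gamma>" "\<gamma> < 1" "\<And>t. \<bar>u t\<bar> \<le> B"
  shows "summable (\<lambda>t. norm (\<gamma> ^ t * u t))"
proof (rule summable_comparison_test')
  show "summable (\<lambda>t. \<gamma> ^ t * B)"
    using assms by (intro summable_mult2 summable_geometric) auto
  show "norm (norm (\<gamma> ^ t * u t)) \<le> \<gamma> ^ t * B" for t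
    using assms by (simp add: abs_mult mult_left_mono)
qed

lemma chain_law_discounted_sum:
  fixes \<iota> :: "'z::finite pmf" and c :: "'z \<Rightarrow> real"
  assumes \<gamma>: "0 \<le> \<gamma>" "\<gamma> < 1"
  shows "(\<integral>\<omega>. (\<Sum>t. \<gamma> ^ t * c (\<omega> t)) \<partial>chain_law \<iota> K) = (\<Sum>z\<in>UNIV. pmf \<iota> z * discounted_value K \<gamma> c z)"
proof -
  let ?M = "chain_law \<iota> K"
  interpret prob_space ?M by (rule prob_space_chain_law)
  define B where "B = Max (range (\<lambda>z. \<bar>c z\<bar>))"
  have B: "\<bar>c z\<bar> \<le> B" for z by (simp add: B_def)
  have "(\<integral>\<omega>. (\<Sum>t. \<gamma> ^ t * c (\<omega> t)) \<partial>?M) = (\<Sum>t. \<integral>\<omega>. \<gamma> ^ t * c (\<omega> t) \<partial>?M)"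
  proof (rule integral_suminf)
    show "integrable ?M (\<lambda>\<omega>. \<gamma> ^ t * c (\<omega> t))" for t
      by (intro integrable_mult_right integrable_chain_law_component)
    show "AE \<omega> in ?M. summable (\<lambda>t. norm (\<gamma> ^ t * c (\<omega> t)))"
      using \<gamma> B by (intro AE_I2 summable_discounted)
    have eq: "(\<integral>\<omega>. norm (\<gamma> ^ t * c (\<omega> t)) \<partial>?M) = norm (\<gamma> ^ t * (\<integral>\<omega>. \<bar>c (\<omega> t)\<bar> \<partial>?M))" for t
      using \<gamma> by (simp add: abs_mult)
    have le: "\<bar>\<integral>\<omega>. \<bar>c (\<omega> t)\<bar> \<partial>?M\<bar> \<le> B" for t
    proof -
      have "\<bar>(kernel_mean K ^^ t) (\<lambda>z. \<bar>c z\<bar>) z\<bar> \<le> B" for z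
        by (rule funpow_kernel_mean_abs_le) (simp add: B)
      then show ?thesis
        unfolding chain_law_expectation[where f = "\<lambda>z. \<bar>c z\<bar>"] by (rule pmf_mean_abs_le)
    qed
    show "summable (\<lambda>t. \<integral>\<omega>. norm (\<gamma> ^ t * c (\<omega> t)) \<partial>?M)"
      unfolding eq by (rule summable_discounted[OF \<gamma> le])
  qed
  also have "\<dots> = (\<Sum>t. \<Sum>z\<in>UNIV. pmf \<iota> z * (\<gamma> ^ t * (kernel_mean K ^^ t) c z))"
    by (simp add: chain_law_expectation sum_distrib_left mult_ac)
  also have "\<dots> = (\<Sum>z\<in>UNIV. \<Sum>t. pmf \<iota> z * (\<gamma> ^ t * (kernel_mean K ^^ t) c z))"
    using summable_discounted[OF \<gamma> funpow_kernel_mean_abs_le, OF B]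
    by (intro suminf_sum summable_mult) (rule summable_norm_cancel)
  also have "\<dots> = (\<Sum>z\<in>UNIV. pmf \<iota> z * discounted_value K \<gamma> c z)"
    unfolding discounted_value_def
    using summable_discounted[OF \<gamma> funpow_kernel_mean_abs_le, OF B]
    by (intro sum.cong refl suminf_mult) (rule summable_norm_cancel)
  finally show ?thesis .
qed

lemma discounted_value_step:
  fixes c :: "'z::finite \<Rightarrow> real"
  assumes \<gamma>: "0 \<le> \<gamma>" "\<gamma> < 1"
  shows "discounted_value K \<gamma> c z = c z + \<gamma> * kernel_mean K (discounted_value K \<gamma> c) z"
proof -
  define B where "B = Max (range (\<lambda>z. \<bar>c z\<bar>))"
  have B: "\<bar>c z\<bar> \<le> B" for z by (simp add: B_def)
  have s: "summable (\<lambda>t. \<gamma> ^ t * (kernel_mean K ^^ t) c z)" for z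
    using summable_discounted[OF \<gamma> funpow_kernel_mean_abs_le, OF B] by (rule summable_norm_cancel)
  have "discounted_value K \<gamma> c z = c z + (\<Sum>t. \<gamma> ^ Suc t * (kernel_mean K ^^ Suc t) c z)"
    unfolding discounted_value_def using suminf_split_head[OF s[of z]] by simp
  also have "(\<Sum>t. \<gamma> ^ Suc t * (kernel_mean K ^^ Suc t) c z)
    = (\<Sum>t. \<Sum>z'\<in>UNIV. \<gamma> * pmf (K z) z' * (\<gamma> ^ t * (kernel_mean K ^^ t) c z'))"
    by (simp add: kernel_mean_def sum_distrib_left mult_ac)
  also have "\<dots> = (\<Sum>z'\<in>UNIV. \<Sum>t. \<gamma> * pmf (K z) z' * (\<gamma> ^ t * (kernel_mean K ^^ t) c z'))"
    by (intro suminf_sum summable_mult s)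
  also have "\<dots> = (\<Sum>z'\<in>UNIV. \<gamma> * pmf (K z) z' * discounted_value K \<gamma> c z')"
    unfolding discounted_value_def by (intro sum.cong refl suminf_mult s)
  also have "\<dots> = \<gamma> * kernel_mean K (discounted_value K \<gamma> c) z"
    by (simp add: kernel_mean_def sum_distrib_left mult_ac)
  finally show ?thesis .
qed

section \<open>The soft Bellman equation\<close>

lemma expectation_finite_type:
  fixes f :: "'z::finite \<Rightarrow> real"
  shows "measure_pmf.expectation p f = (\<Sum>z\<in>UNIV. pmf p z * f z)"
  by (simp add: integral_measure_pmf[of UNIV])

lemma sum_pmf_map_Pair:
  fixes f :: "'s::finite \<times> 'a::finite \<Rightarrow> real"
  shows "(\<Sum>z\<in>UNIV. pmf (map_pmf (Pair s) p) z * f z) = (\<Sum>a\<in>UNIV. pmf p a * f (s, a))"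
  by (simp flip: expectation_finite_type)

lemma kernel_mean_state_action:
  fixes f :: "'s::finite \<times> 'a::finite \<Rightarrow> real"
  shows "kernel_mean (state_action_kernel P \<pi>) f (s, a) =
    (\<Sum>s'\<in>UNIV. pmf (P s a) s' * (\<Sum>a'\<in>UNIV. pmf (\<pi> s') a' * f (s', a')))"
proof -
  have "kernel_mean (state_action_kernel P \<pi>) f (s, a)
    = measure_pmf.expectation (state_action_kernel P \<pi> (s, a)) f"
    by (simp add: kernel_mean_def expectation_finite_type)
  also have "\<dots> = (\<Sum>s'\<in>UNIV. pmf (P s a) s' * (\<Sum>a'\<in>UNIV. pmf (\<pi> s') a' * f (s', a')))"
    unfolding state_action_kernel_def prod.case
    by (subst pmf_expectation_bind[of UNIV]) (auto simp: expectation_finite_type sum_pmf_map_Pair)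
  finally show ?thesis .
qed

text \<open>
  The state-action pairs under \<open>\<pi>\<close> form a Markov chain, so the return is a discounted value of that
  chain for the reward augmented by the entropy bonus.
\<close>

lemma regularized_return_bellman:
  fixes r :: "'s::finite \<Rightarrow> 'a::finite \<Rightarrow> real"
  assumes \<gamma>: "0 \<le> \<gamma>" "\<gamma> < 1"
  shows "regularized_return r P \<gamma> lam (return_pmf s) \<pi> =
    (\<Sum>a\<in>UNIV. pmf (\<pi> s) a * soft_Q r P \<gamma> lam \<pi> s a) + lam * policy_entropy \<pi> s"
proof -
  let ?K = "state_action_kernel P \<pi>"
  define c where "c = (\<lambda>(s, a). r s a + lam * policy_entropy \<pi> s)"
  let ?W = "discounted_value ?K \<gamma> c"
  have return_eq: "regularized_return r P \<gamma> lam (return_pmf s) \<pi> = (\<Sum>a\<in>UNIV. pmf (\<pi> s) a * ?W (s, a))" for s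
  proof -
    have "regularized_return r P \<gamma> lam (return_pmf s) \<pi>
      = (\<integral>\<omega>. (\<Sum>t. \<gamma> ^ t * c (\<omega> t)) \<partial>chain_law (map_pmf (Pair s) (\<pi> s)) ?K)"
      by (simp add: regularized_return_def mdp_law_def c_def bind_return_pmf case_prod_unfold)
    also have "\<dots> = (\<Sum>a\<in>UNIV. pmf (\<pi> s) a * ?W (s, a))"
      by (simp add: chain_law_discounted_sum[OF \<gamma>] sum_pmf_map_Pair)
    finally show ?thesis .
  qed
  have W: "?W (s, a) = soft_Q r P \<gamma> lam \<pi> s a + lam * policy_entropy \<pi> s" for s a
    by (subst discounted_value_step[OF \<gamma>])
      (simp add: kernel_mean_state_action soft_Q_def return_eq c_def)
  show ?thesis
    by (simp add: return_eq W ring_distribs sum.distrib sum_pmf_UNIV flip: sum_distrib_right)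
qed

definition soft_bellman ::
    "('s::finite \<Rightarrow> 'a::finite \<Rightarrow> real) \<Rightarrow> ('s \<Rightarrow> 'a \<Rightarrow> 's pmf) \<Rightarrow> real \<Rightarrow> real \<Rightarrow> ('s \<Rightarrow> 'a \<Rightarrow> real) \<Rightarrow> 's \<Rightarrow> 'a \<Rightarrow> real"
  where
  "soft_bellman r P \<gamma> lam Q s a = r s a + \<gamma> * (\<Sum>s'\<in>UNIV. pmf (P s a) s' * soft_maximum lam (Q s'))"

lemma sum_pmf_abs_diff_le:
  fixes p :: "'z::finite pmf"
  assumes "\<And>z. \<bar>f z - g z\<bar> \<le> c"
  shows "\<bar>(\<Sum>z\<in>UNIV. pmf p z * f z) - (\<Sum>z\<in>UNIV. pmf p z * g z)\<bar> \<le> c"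
  using pmf_mean_abs_le[of "\<lambda>z. f z - g z" c p] assms
  by (simp add: right_diff_distrib sum_subtractf)

lemma soft_bellman_contraction:
  assumes "0 \<le> \<gamma>" "0 < lam" "\<And>s a. \<bar>Q s a - Q' s a\<bar> \<le> c"
  shows "\<bar>soft_bellman r P \<gamma> lam Q s a - soft_bellman r P \<gamma> lam Q' s a\<bar> \<le> \<gamma> * c"
proof -
  have "\<bar>(\<Sum>s'\<in>UNIV. pmf (P s a) s' * soft_maximum lam (Q s')) - (\<Sum>s'\<in>UNIV. pmf (P s a) s' * soft_maximum lam (Q' s'))\<bar> \<le> c"
    using assms by (intro sum_pmf_abs_diff_le soft_maximum_lipschitz)
  then have "\<gamma> * \<bar>(\<Sum>s'\<in>UNIV. pmf (P s a) s' * soft_maximum lam (Q s')) - (\<Sum>s'\<in>UNIV. pmf (P s a) s' * soft_maximum lam (Q' s'))\<bar> \<le> \<gamma> * c"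
    using assms(1) by (rule mult_left_mono)
  then show ?thesis
    using assms(1) by (simp add: soft_bellman_def abs_mult flip: right_diff_distrib)
qed

text \<open>
  Value iteration: successive iterates differ by a geometric sequence, so every entry converges.
\<close>

lemma soft_bellman_fixed_point_exists:
  fixes r :: "'s::finite \<Rightarrow> 'a::finite \<Rightarrow> real"
  assumes \<gamma>: "0 \<le> \<gamma>" "\<gamma> < 1" and lam: "0 < lam"
  obtains Q where "soft_bellman r P \<gamma> lam Q = Q"
proof -
  let ?T = "soft_bellman r P \<gamma> lam"
  define q where "q n = (?T ^^ n) (\<lambda>_ _. 0)" for n
  have q_Suc: "q (Suc n) = ?T (q n)" for n by (simp add: q_def)
  define c where "c = Max (range (\<lambda>(s, a). \<bar>q 1 s a - q 0 s a\<bar>))"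
  have step: "\<bar>q (Suc n) s a - q n s a\<bar> \<le> \<gamma> ^ n * c" for n s a
  proof (induction n arbitrary: s a)
    case 0
    have "\<bar>q 1 s a - q 0 s a\<bar> \<le> c" unfolding c_def by (rule Max_ge) auto
    then show ?case by simp
  next
    case (Suc n)
    show ?case
      unfolding q_Suc[of "Suc n"] q_Suc[of n]
      using soft_bellman_contraction[OF \<gamma>(1) lam Suc.IH[unfolded q_Suc]] by (simp add: mult_ac)
  qed
  have "convergent (\<lambda>n. q n s a)" for s a
  proof -
    have "summable (\<lambda>n. \<gamma> ^ n * c)"
      using \<gamma> by (intro summable_mult2 summable_geometric) auto
    then have "summable (\<lambda>n. q (Suc n) s a - q n s a)"
      by (rule summable_comparison_test') (use step in auto)
    then have "convergent (\<lambda>n. \<Sum>i<n. q (Suc i) s a - q i s a)"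
      by (simp add: summable_iff_convergent)
    then have "convergent (\<lambda>n. q n s a - q 0 s a)"
      using sum_lessThan_telescope[of "\<lambda>n. q n s a"] by simp
    then show ?thesis by (simp add: convergent_diff_const_right_iff)
  qed
  then obtain Q where Q: "(\<lambda>n. q n s a) \<longlonglongrightarrow> Q s a" for s a
    unfolding convergent_def by metis
  have "?T Q s a = Q s a" for s a
  proof (rule LIMSEQ_unique)
    show "(\<lambda>n. q (Suc n) s a) \<longlonglongrightarrow> Q s a"
      using Q[of s a] by (rule LIMSEQ_Suc)
    show "(\<lambda>n. q (Suc n) s a) \<longlonglongrightarrow> ?T Q s a"
      unfolding q_Suc soft_bellman_def soft_maximum_def
      using lam sum_exp_pos[where ?'a = 'a, THEN less_imp_neq]
      by (intro tendsto_intros Q) (auto dest: sym)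
  qed
  then show thesis by (intro that[of Q]) (simp add: fun_eq_iff)
qed

text \<open>
  The gap between \<open>soft_maximum lam (Q s)\<close> and the return of \<open>\<pi>\<close> satisfies a discounted linear
  recursion whose source term is the defect in Gibbs' inequality for \<open>\<pi> s\<close>. This source is
  nonnegative, and it vanishes for the softmax policy. Looking at the state where the gap is extreme
  gives its sign.
\<close>

lemma soft_bellman_fixed_point_bounds_return:
  fixes Q :: "'s::finite \<Rightarrow> 'a::finite \<Rightarrow> real"
  assumes \<gamma>: "0 \<le> \<gamma>" "\<gamma> < 1" and lam: "0 < lam" and fix_Q: "soft_bellman r P \<gamma> lam Q = Q"
  shows "regularized_return r P \<gamma> lam (return_pmf s) \<pi> \<le> soft_maximum lam (Q s)"
    and "regularized_return r P \<gamma> lam (return_pmf s) (softmax_policy lam Q) = soft_maximum lam (Q s)"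
proof -
  define gap where "gap \<pi> s = soft_maximum lam (Q s) - regularized_return r P \<gamma> lam (return_pmf s) \<pi>" for \<pi> s
  define advantage where
    "advantage \<pi> s = soft_maximum lam (Q s) - ((\<Sum>a\<in>UNIV. pmf (\<pi> s) a * Q s a) + lam * policy_entropy \<pi> s)" for \<pi> s
  have Q_eq: "Q s a = r s a + \<gamma> * (\<Sum>s'\<in>UNIV. pmf (P s a) s' * soft_maximum lam (Q s'))" for s a
    using fix_Q by (metis soft_bellman_def)
  have gap_Q: "Q s a - soft_Q r P \<gamma> lam \<pi> s a = \<gamma> * (\<Sum>s'\<in>UNIV. pmf (P s a) s' * gap \<pi> s')" for \<pi> s a
    by (subst Q_eq) (simp add: soft_Q_def gap_def right_diff_distrib sum_subtractf)
  have gap_rec: "gap \<pi> s = advantage \<pi> s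
      + \<gamma> * (\<Sum>a\<in>UNIV. pmf (\<pi> s) a * (\<Sum>s'\<in>UNIV. pmf (P s a) s' * gap \<pi> s'))" for \<pi> s
  proof -
    have "(\<Sum>a\<in>UNIV. pmf (\<pi> s) a * Q s a) - (\<Sum>a\<in>UNIV. pmf (\<pi> s) a * soft_Q r P \<gamma> lam \<pi> s a)
      = (\<Sum>a\<in>UNIV. pmf (\<pi> s) a * (\<gamma> * (\<Sum>s'\<in>UNIV. pmf (P s a) s' * gap \<pi> s')))"
      by (simp flip: gap_Q right_diff_distrib sum_subtractf)
    then show ?thesis
      unfolding gap_def[of \<pi> s] advantage_def regularized_return_bellman[OF \<gamma>]
      by (simp add: sum_distrib_left mult_ac)
  qed
  have mean_ge: "m \<le> (\<Sum>a\<in>UNIV. pmf (\<pi> s) a * (\<Sum>s'\<in>UNIV. pmf (P s a) s' * f s'))"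
    if "\<And>s. m \<le> f s" for m \<pi> s and f :: "'s \<Rightarrow> real"
  proof -
    have weighted: "m \<le> (\<Sum>z\<in>UNIV. pmf p z * g z)" if "\<And>z. m \<le> g z" for p :: "'z::finite pmf" and g
      using pmf_mean_mono[of "\<lambda>_. m" g p] that unfolding pmf_mean_const by simp
    show ?thesis by (intro weighted that)
  qed
  have nonneg: "0 \<le> gap \<pi> s" if adv: "\<And>s. 0 \<le> advantage \<pi> s" for \<pi> s
  proof -
    define m where "m = Min (range (gap \<pi>))"
    have m_le: "m \<le> gap \<pi> s" for s by (simp add: m_def)
    have "m \<in> range (gap \<pi>)" unfolding m_def by (rule Min_in) auto
    then obtain s0 where "m = gap \<pi> s0" by auto
    then have "\<gamma> * m \<le> m"
      using gap_rec[of \<pi> s0] adv[of s0] mult_left_mono[OF mean_ge[of m "gap \<pi>", OF m_le] \<gamma>(1), of \<pi> s0] by linarith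
    then have "0 \<le> (1 - \<gamma>) * m" by (simp add: algebra_simps)
    then have "0 \<le> m" using \<gamma> by (simp add: zero_le_mult_iff)
    then show ?thesis using m_le[of s] by linarith
  qed
  show "regularized_return r P \<gamma> lam (return_pmf s) \<pi> \<le> soft_maximum lam (Q s)"
  proof -
    have "0 \<le> advantage \<pi> s" for s
      using gibbs_variational_inequality[OF lam, of "\<pi> s" "Q s" s]
      by (simp add: advantage_def policy_entropy_def)
    then show ?thesis using nonneg[of \<pi> s] by (simp add: gap_def)
  qed
  show "regularized_return r P \<gamma> lam (return_pmf s) (softmax_policy lam Q) = soft_maximum lam (Q s)"
  proof -
    let ?\<pi> = "softmax_policy lam Q"
    have adv: "advantage ?\<pi> s = 0" for s
      by (simp add: advantage_def gibbs_variational_equality[OF lam])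
    define m where "m = Max (range (gap ?\<pi>))"
    have m_ge: "gap ?\<pi> s \<le> m" for s by (simp add: m_def)
    have "m \<in> range (gap ?\<pi>)" unfolding m_def by (rule Max_in) auto
    then obtain s0 where "m = gap ?\<pi> s0" by auto
    moreover have "(\<Sum>a\<in>UNIV. pmf (?\<pi> s0) a * (\<Sum>s'\<in>UNIV. pmf (P s0 a) s' * gap ?\<pi> s')) \<le> m"
      using mean_ge[of "- m" "\<lambda>s. - gap ?\<pi> s" ?\<pi> s0] m_ge by (simp add: sum_negf)
    ultimately have "m \<le> \<gamma> * m"
      using gap_rec[of ?\<pi> s0] adv[of s0] mult_left_mono[OF _ \<gamma>(1)] by fastforce
    then have "(1 - \<gamma>) * m \<le> 0" by (simp add: algebra_simps)
    then have "m \<le> 0" using \<gamma> by (simp add: mult_le_0_iff)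
    then have "gap ?\<pi> s = 0"
      using nonneg[of ?\<pi> s] m_ge[of s] adv by fastforce
    then show ?thesis by (simp add: gap_def)
  qed
qed

lemma soft_bellman_optimal_soft_Q:
  fixes r :: "'s::finite \<Rightarrow> 'a::finite \<Rightarrow> real"
  assumes \<gamma>: "0 \<le> \<gamma>" "\<gamma> < 1" and lam: "0 < lam"
  shows "soft_bellman r P \<gamma> lam (optimal_soft_Q r P \<gamma> lam) = optimal_soft_Q r P \<gamma> lam"
proof -
  obtain Q where Q: "soft_bellman r P \<gamma> lam Q = Q"
    using soft_bellman_fixed_point_exists[OF assms] .
  have "optimal_soft_Q r P \<gamma> lam s a = Q s a" for s a
    unfolding optimal_soft_Q_def
  proof (rule cSup_eq_maximum)
    have "soft_Q r P \<gamma> lam (softmax_policy lam Q) s a = soft_bellman r P \<gamma> lam Q s a"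
      by (simp add: soft_Q_def soft_bellman_def soft_bellman_fixed_point_bounds_return(2)[OF \<gamma> lam Q])
    then show "Q s a \<in> range (\<lambda>\<pi>. soft_Q r P \<gamma> lam \<pi> s a)"
      by (metis Q rangeI)
  next
    fix x assume "x \<in> range (\<lambda>\<pi>. soft_Q r P \<gamma> lam \<pi> s a)"
    then obtain \<pi> where "x = soft_Q r P \<gamma> lam \<pi> s a" by auto
    also have "\<dots> \<le> soft_bellman r P \<gamma> lam Q s a"
      unfolding soft_Q_def soft_bellman_def using \<gamma>(1)
      by (intro add_left_mono mult_left_mono sum_mono soft_bellman_fixed_point_bounds_return(1)[OF \<gamma> lam Q]) auto
    finally show "x \<le> Q s a" by (simp add: Q)
  qed
  then have "optimal_soft_Q r P \<gamma> lam = Q" by (simp add: fun_eq_iff)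
  then show ?thesis using Q by simp
qed

section \<open>The Poisson equation\<close>

text \<open>
  The maximum principle: where a harmonic function attains its maximum, it takes the same value
  at all successors, hence at all states that can be reached.
\<close>

lemma irreducible_harmonic_const:
  fixes K :: "'z::finite \<Rightarrow> 'z pmf" and f :: "'z \<Rightarrow> real"
  assumes irr: "irreducible_chain K"
    and harmonic: "\<And>z. f z = (\<Sum>z'\<in>UNIV. pmf (K z) z' * f z')"
  shows "f z = f z'"
proof -
  define m where "m = Max (range f)"
  have le: "f z \<le> m" for z by (simp add: m_def)
  obtain z0 where z0: "f z0 = m"
    using Max_in[of "range f"] unfolding m_def by (metis UNIV_not_empty empty_is_image finite finite_imageI imageE)
  have reach: "f z = m" if "z \<in> set_pmf (n_step K n z0)" for n z
    using that
  proof (induction n arbitrary: z)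
    case 0
    then show ?case by (simp add: n_step_def z0)
  next
    case (Suc n)
    then obtain x where x: "x \<in> set_pmf (n_step K n z0)" "z \<in> set_pmf (K x)"
      by (auto simp: n_step_def)
    have "f x = m" by (rule Suc.IH) fact
    have "(\<Sum>z'\<in>UNIV. pmf (K x) z' * (m - f z')) = 0"
      using harmonic[of x] \<open>f x = m\<close>
      by (simp add: right_diff_distrib sum_subtractf sum_pmf_UNIV flip: sum_distrib_right)
    then have "pmf (K x) z * (m - f z) = 0"
      by (subst (asm) sum_nonneg_eq_0_iff) (auto simp: le)
    then show ?case using x(2) by (simp add: set_pmf_iff)
  qed
  have "f z = m" for z
  proof -
    obtain n where "pmf (n_step K n z0) z > 0"
      using irr unfolding irreducible_chain_def by blast
    then show ?thesis by (intro reach[of z n]) (simp add: set_pmf_iff)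
  qed
  then show ?thesis by simp
qed

lemma stationary_mean:
  fixes K :: "'z::finite \<Rightarrow> 'z pmf" and f :: "'z \<Rightarrow> real"
  assumes "stationary_pmf K \<nu>"
  shows "(\<Sum>z\<in>UNIV. pmf \<nu> z * (\<Sum>z'\<in>UNIV. pmf (K z) z' * f z')) = (\<Sum>z\<in>UNIV. pmf \<nu> z * f z)"
proof -
  have "measure_pmf.expectation (bind_pmf \<nu> K) f = (\<Sum>z\<in>UNIV. pmf \<nu> z * (\<Sum>z'\<in>UNIV. pmf (K z) z' * f z'))"
    by (subst pmf_expectation_bind[of UNIV]) (auto simp: integral_measure_pmf[of UNIV])
  moreover have "measure_pmf.expectation \<nu> f = (\<Sum>z\<in>UNIV. pmf \<nu> z * f z)"
    by (simp add: integral_measure_pmf[of UNIV])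
  ultimately show ?thesis
    using assms by (simp add: stationary_pmf_def)
qed

text \<open>
  Let \<open>A\<close> map \<open>g\<close> to \<open>g - K g\<close> plus the stationary mean of \<open>g\<close>. Since \<open>g - K g\<close> has mean zero, \<open>A\<close>
  preserves the mean; its kernel therefore consists of harmonic functions of mean zero and is
  trivial. On a finite-dimensional space an injective linear map is onto.
\<close>

lemma poisson_equation:
  fixes K :: "'z::finite \<Rightarrow> 'z pmf" and f :: "'z \<Rightarrow> real"
  assumes irr: "irreducible_chain K" and stat: "stationary_pmf K \<nu>"
  obtains g :: "'z \<Rightarrow> real"
  where "\<And>z. g z - (\<Sum>z'\<in>UNIV. pmf (K z) z' * g z') = f z - (\<Sum>z\<in>UNIV. pmf \<nu> z * f z)"
proof -
  let ?K = "\<lambda>f z. \<Sum>z'\<in>UNIV. pmf (K z) z' * f z'"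
  let ?\<nu> = "\<lambda>f. \<Sum>z\<in>UNIV. pmf \<nu> z * f z"
  define A :: "real ^ 'z \<Rightarrow> real ^ 'z" where
    "A v = (\<chi> z. v $ z - ?K (($) v) z + ?\<nu> (($) v))" for v
  have mean_A: "?\<nu> (\<lambda>z. A v $ z) = ?\<nu> (($) v)" for v
    by (simp add: A_def sum.distrib sum_subtractf ring_distribs sum_pmf_UNIV stationary_mean[OF stat]
        flip: sum_distrib_right)
  have lin: "linear A"
    by (rule linearI)
      (simp_all add: A_def vec_eq_iff sum.distrib algebra_simps sum_distrib_left)
  have "inj A"
  proof (rule linear_injective_0[OF lin, THEN iffD2], intro allI impI)
    fix v assume v: "A v = 0"
    have mean0: "?\<nu> (($) v) = 0" using mean_A[of v] v by simp
    have "v $ z = ?K (($) v) z" for z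
      using arg_cong[OF v, of "\<lambda>u. u $ z"] mean0 by (simp add: A_def)
    then have const: "v $ z = v $ z'" for z z'
      by (rule irreducible_harmonic_const[OF irr])
    have "v $ z = 0" for z
    proof -
      have "?\<nu> (($) v) = (\<Sum>z'\<in>UNIV. pmf \<nu> z' * v $ z)"
        using const by (intro sum.cong) auto
      also have "\<dots> = v $ z"
        by (simp add: sum_pmf_UNIV flip: sum_distrib_right)
      finally have "?\<nu> (($) v) = v $ z" .
      then show ?thesis using mean0 by simp
    qed
    then show "v = 0" by (simp add: vec_eq_iff)
  qed
  then have "surj A"
    using linear_injective_imp_surjective[OF lin] by simp
  then obtain v where v: "A v = (\<chi> z. f z)" by (metis surjD)
  have "?\<nu> f = ?\<nu> (($) v)"
    using mean_A[of v] unfolding v by simp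
  then have "v $ z - ?K (($) v) z = f z - ?\<nu> f" for z
    using arg_cong[OF v, of "\<lambda>u. u $ z"] by (simp add: A_def)
  then show thesis by (rule that)
qed

section \<open>Inequalities for powers and the decay of a recursion\<close>

text \<open>
  Taylor expansion of a power to first order. Both \<open>\<bar>x\<bar>\<close> and \<open>\<alpha>\<close> are treated as quantities of the same
  size \<open>m\<close>, because \<open>\<alpha>\<close> may be much larger than \<open>\<bar>x\<bar>\<close>. The induction runs with the binomial expansion of
  \<open>(1 + E) ^ (n + 2)\<close> without its first two terms as the constant, because this one reproduces itself.
\<close>

lemma power_taylor_bound:
  fixes x \<alpha> e E :: real
  assumes "0 \<le> \<alpha>" and "\<bar>e\<bar> \<le> E"
  shows "\<bar>(x + \<alpha> * e) ^ (n + 2) - x ^ (n + 2) - real (n + 2) * (\<alpha> * e) * x ^ (n + 1)\<bar>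
    \<le> (1 + E) ^ (n + 2) * \<alpha>\<^sup>2 * (\<bar>x\<bar> ^ n + \<alpha> ^ n)"
proof -
  define m where "m = max \<bar>x\<bar> \<alpha>"
  have m: "\<bar>x\<bar> \<le> m" "\<alpha> \<le> m" "0 \<le> m" using assms by (auto simp: m_def)
  have E: "0 \<le> E" using assms by linarith
  let ?h = "\<alpha> * e"
  define R where "R n = (x + ?h) ^ (n + 2) - x ^ (n + 2) - real (n + 2) * ?h * x ^ (n + 1)" for n
  have h: "\<bar>?h\<bar> \<le> \<alpha> * E" using assms by (simp add: abs_mult mult_left_mono)
  have h2: "?h\<^sup>2 \<le> E\<^sup>2 * \<alpha>\<^sup>2"
    using power_mono[OF h, of 2] by (simp add: power_mult_distrib mult.commute)
  have "\<bar>R n\<bar> \<le> ((1 + E) ^ (n + 2) - 1 - real (n + 2) * E) * \<alpha>\<^sup>2 * m ^ n"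
  proof (induction n)
    case 0
    have "R 0 = ?h\<^sup>2" by (simp add: R_def power2_eq_square algebra_simps)
    then have "\<bar>R 0\<bar> \<le> E\<^sup>2 * \<alpha>\<^sup>2" using h2 by simp
    then show ?case by (simp add: power2_eq_square algebra_simps)
  next
    case (Suc n)
    have R_Suc: "R (Suc n) = (x + ?h) * R n + real (n + 2) * ?h\<^sup>2 * x ^ (n + 1)"
      by (simp add: R_def power2_eq_square algebra_simps)
    have "\<bar>x + ?h\<bar> \<le> m + m * E"
      using m h mult_right_mono[OF m(2) E] by linarith
    then have "\<bar>(x + ?h) * R n\<bar> \<le> ((1 + E) * m) * (((1 + E) ^ (n + 2) - 1 - real (n + 2) * E) * \<alpha>\<^sup>2 * m ^ n)"
      unfolding abs_mult using Suc.IH m(3) E by (intro mult_mono) (auto simp: algebra_simps)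
    moreover have "\<bar>real (n + 2) * ?h\<^sup>2 * x ^ (n + 1)\<bar> \<le> real (n + 2) * (E\<^sup>2 * \<alpha>\<^sup>2) * m ^ (n + 1)"
      unfolding abs_mult power_abs using h2 m
      by (intro mult_mono power_mono) (auto simp: abs_mult power_mult_distrib)
    ultimately have "\<bar>R (Suc n)\<bar> \<le> ((1 + E) * m) * (((1 + E) ^ (n + 2) - 1 - real (n + 2) * E) * \<alpha>\<^sup>2 * m ^ n)
        + real (n + 2) * (E\<^sup>2 * \<alpha>\<^sup>2) * m ^ (n + 1)"
      unfolding R_Suc by linarith
    also have "\<dots> = ((1 + E) ^ (Suc n + 2) - 1 - real (Suc n + 2) * E) * \<alpha>\<^sup>2 * m ^ Suc n"
      by (simp add: power2_eq_square algebra_simps)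
    finally show ?case .
  qed
  also have "\<dots> \<le> (1 + E) ^ (n + 2) * \<alpha>\<^sup>2 * m ^ n"
  proof (intro mult_right_mono)
    have "0 \<le> real (n + 2) * E" using E by simp
    then show "(1 + E) ^ (n + 2) - 1 - real (n + 2) * E \<le> (1 + E) ^ (n + 2)" by linarith
  qed (use m in auto)
  also have "\<dots> \<le> (1 + E) ^ (n + 2) * \<alpha>\<^sup>2 * (\<bar>x\<bar> ^ n + \<alpha> ^ n)"
    using E assms by (intro mult_left_mono) (auto simp: m_def max_def)
  finally show ?thesis by (simp add: R_def)
qed

text \<open>
  Young's inequality with integer exponents; the induction step costs the square
  \<open>(m + 1) * a ^ m * (b - a)^2\<close>.
\<close>

lemma power_young:
  fixes a b :: real
  assumes "0 \<le> a" "0 \<le> b"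
  shows "real (m + 1) * a ^ m * b \<le> real m * a ^ (m + 1) + b ^ (m + 1)"
proof (induction m)
  case 0
  then show ?case by simp
next
  case (Suc m)
  have "b * (real (m + 1) * a ^ m * b) \<le> b * (real m * a ^ (m + 1) + b ^ (m + 1))"
    using Suc assms by (intro mult_left_mono) auto
  moreover have "0 \<le> real (m + 1) * a ^ m * (b - a)\<^sup>2"
    using assms by simp
  ultimately show ?case
    by (simp add: power2_eq_square algebra_simps)
qed

text \<open>
  Here \<open>x\<close> is one entry of the error, \<open>N\<close> its supremum norm and \<open>G\<close> the image of the error under the
  contraction. The right-hand side is linear in the powers \<open>x ^ (2 * n + 2)\<close> and \<open>N ^ (2 * n + 2)\<close>.
\<close>

lemma power_drift_bound:
  fixes x G N :: real
  assumes G: "\<bar>G\<bar> \<le> \<gamma> * N" and "0 \<le> \<gamma>" "0 \<le> N"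
  shows "real (2 * n + 2) * (G - x) * x ^ (2 * n + 1)
    \<le> - (real (2 * n + 2) - \<gamma> * real (2 * n + 1)) * x ^ (2 * n + 2) + \<gamma> * N ^ (2 * n + 2)"
proof -
  have ev: "\<bar>x\<bar> ^ (2 * n + 2) = x ^ (2 * n + 2)" by (simp add: power_even_abs)
  have "G * x ^ (2 * n + 1) \<le> \<bar>G\<bar> * \<bar>x\<bar> ^ (2 * n + 1)"
    by (metis abs_ge_self abs_mult power_abs)
  also have "\<dots> \<le> \<gamma> * N * \<bar>x\<bar> ^ (2 * n + 1)"
    using G by (intro mult_right_mono) auto
  finally have "real (2 * n + 2) * (G * x ^ (2 * n + 1)) \<le> real (2 * n + 2) * (\<gamma> * N * \<bar>x\<bar> ^ (2 * n + 1))"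
    by (intro mult_left_mono) auto
  also have "\<dots> = \<gamma> * (real (2 * n + 2) * \<bar>x\<bar> ^ (2 * n + 1) * N)" by simp
  also have "\<dots> \<le> \<gamma> * (real (2 * n + 1) * x ^ (2 * n + 2) + N ^ (2 * n + 2))"
    using power_young[of "\<bar>x\<bar>" N "2 * n + 1"] assms ev by (intro mult_left_mono) auto
  finally show ?thesis by (simp add: algebra_simps)
qed

text \<open>
  Either \<open>\<alpha> \<le> \<epsilon> * x^2\<close>, and the drift dominates the noise, or \<open>x^2\<close> is at most \<open>\<alpha> / \<epsilon>\<close>. The exponent
  \<open>n + 2\<close> is one more than half of \<open>2 * n + 2\<close>, so that with step sizes of order \<open>1 / t\<close> the noise leaves the
  power \<open>2 * n + 2\<close> of the error of order \<open>t ^ (- (n + 1))\<close>.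
\<close>

lemma noise_absorption:
  fixes x \<alpha> \<epsilon> :: real
  assumes "0 \<le> \<alpha>" "0 < \<epsilon>"
  shows "\<alpha>\<^sup>2 * x ^ (2 * n) \<le> \<epsilon> * \<alpha> * x ^ (2 * n + 2) + \<alpha> ^ (n + 2) / \<epsilon> ^ n"
proof (cases "\<alpha> \<le> \<epsilon> * x\<^sup>2")
  case True
  have "\<alpha> * (\<alpha> * x ^ (2 * n)) \<le> \<alpha> * ((\<epsilon> * x\<^sup>2) * x ^ (2 * n))"
    using True assms by (intro mult_left_mono mult_right_mono) auto
  then have "\<alpha>\<^sup>2 * x ^ (2 * n) \<le> \<epsilon> * \<alpha> * x ^ (2 * n + 2)"
    by (simp add: power2_eq_square mult_ac)
  moreover have "0 \<le> \<alpha> ^ (n + 2) / \<epsilon> ^ n" using assms by simp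
  ultimately show ?thesis by linarith
next
  case False
  then have "x\<^sup>2 \<le> \<alpha> / \<epsilon>" using assms by (simp add: field_simps)
  then have "(x\<^sup>2) ^ n \<le> (\<alpha> / \<epsilon>) ^ n" by (intro power_mono) auto
  then have "\<alpha>\<^sup>2 * x ^ (2 * n) \<le> \<alpha>\<^sup>2 * (\<alpha> / \<epsilon>) ^ n"
    by (intro mult_left_mono) (auto simp: power_mult)
  also have "\<dots> = \<alpha> ^ (n + 2) / \<epsilon> ^ n" by (simp add: power_divide power_add power2_eq_square)
  finally have "\<alpha>\<^sup>2 * x ^ (2 * n) \<le> \<alpha> ^ (n + 2) / \<epsilon> ^ n" .
  moreover have "0 \<le> \<epsilon> * \<alpha> * x ^ (2 * n + 2)"
    using assms by (intro mult_nonneg_nonneg zero_le_even_power) auto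
  ultimately show ?thesis by linarith
qed

text \<open>
  With \<open>c\<close> of the order of the expected size of \<open>X\<close>, this bounds a mean by a higher moment
  and replaces Jensen's inequality.
\<close>

lemma le_add_power_div:
  fixes X c :: real
  assumes "0 \<le> X" "0 < c"
  shows "X \<le> c + X ^ (n + 1) / c ^ n"
proof (cases "X \<le> c")
  case True
  moreover have "0 \<le> X ^ (n + 1) / c ^ n" using assms by simp
  ultimately show ?thesis by linarith
next
  case False
  then have "c ^ n \<le> X ^ n" using assms by (intro power_mono) auto
  then have "X * c ^ n \<le> X * X ^ n" using assms by (intro mult_left_mono)
  then have "X \<le> X ^ (n + 1) / c ^ n" using assms by (simp add: pos_le_divide_eq)
  then show ?thesis using assms by linarith
qed

text \<open>
  By Bernoulli's inequality, one step multiplies the sequence \<open>M / (t + b) ^ q\<close> by at least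
  \<open>1 - q / (t + b)\<close>. The recursion contracts by \<open>1 - (q + 1) / (t + b)\<close>, and the surplus \<open>1 / (t + b)\<close>
  pays for the noise.
\<close>

lemma harmonic_step_decay:
  fixes v :: "nat \<Rightarrow> real"
  assumes rec: "\<And>t. v (Suc t) \<le> (1 - \<kappa> * (a / (real t + b))) * v t + R * (a / (real t + b)) ^ (q + 1)"
    and a: "0 < a" and \<kappa>a: "\<kappa> * a = real q + 1" and b: "\<kappa> * a \<le> b" and R: "0 \<le> R"
  obtains M where "\<And>t. v t \<le> M / (real t + b) ^ q"
proof -
  have b0: "0 < b" using \<kappa>a b by linarith
  define M where "M = max (R * a ^ (q + 1)) (v 0 * b ^ q)"
  have M: "R * a ^ (q + 1) \<le> M" "v 0 * b ^ q \<le> M" by (auto simp: M_def)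
  have M0: "0 \<le> M" using M(1) R a by (meson dual_order.trans mult_nonneg_nonneg zero_le_power less_imp_le)
  have "v t \<le> M / (real t + b) ^ q" for t
  proof (induction t)
    case 0
    then show ?case using M b0 by (simp add: pos_le_divide_eq)
  next
    case (Suc t)
    define N where "N = real t + b"
    have N: "0 < N" "\<kappa> * a \<le> N" using b0 b by (auto simp: N_def)
    have "v (Suc t) \<le> (1 - \<kappa> * (a / N)) * v t + R * (a / N) ^ (q + 1)"
      using rec[of t] by (simp add: N_def)
    also have "\<dots> \<le> (1 - \<kappa> * (a / N)) * (M / N ^ q) + R * (a / N) ^ (q + 1)"
      using Suc N by (intro add_right_mono mult_left_mono) (auto simp: N_def field_simps)
    also have "R * (a / N) ^ (q + 1) = R * a ^ (q + 1) / N / N ^ q"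
      by (simp add: power_divide)
    also have "\<dots> \<le> M / N / N ^ q"
      using M(1) N by (intro divide_right_mono) auto
    also have "(1 - \<kappa> * (a / N)) * (M / N ^ q) + M / N / N ^ q = (1 - real q / N) * (M / N ^ q)"
    proof -
      have "\<kappa> * (a / N) = (real q + 1) / N" using \<kappa>a by simp
      then show ?thesis by (simp add: algebra_simps add_divide_distrib)
    qed
    also have "\<dots> \<le> (N / (N + 1)) ^ q * (M / N ^ q)"
    proof (intro mult_right_mono)
      have "1 + real q * (- (1 / (N + 1))) \<le> (1 + - (1 / (N + 1))) ^ q"
        using N by (intro Bernoulli_inequality) (simp add: field_simps)
      moreover have "1 + - (1 / (N + 1)) = N / (N + 1)" using N by (simp add: field_simps)
      moreover have "real q / (N + 1) \<le> real q / N" using N by (intro divide_left_mono) auto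
      ultimately show "1 - real q / N \<le> (N / (N + 1)) ^ q" by simp
    qed (use M0 N in auto)
    also have "\<dots> = M / (N + 1) ^ q" using N by (simp add: power_divide)
    finally show ?case by (simp add: N_def algebra_simps)
  qed
  then show thesis by (rule that)
qed

section \<open>A Lyapunov function for soft Q-learning\<close>

locale soft_Q_exploration =
  fixes r :: "'s::finite \<Rightarrow> 'a::finite \<Rightarrow> real"
    and P :: "'s \<Rightarrow> 'a \<Rightarrow> 's pmf"
    and \<gamma> lam :: real
    and \<pi>B :: "'s \<Rightarrow> 'a pmf"
    and \<nu> :: "('s \<times> 'a) pmf"
    and Qstar :: "'s \<Rightarrow> 'a \<Rightarrow> real"
  assumes \<gamma>: "0 < \<gamma>" "\<gamma> < 1"
    and lam: "0 < lam"
    and irreducible: "irreducible_chain (state_action_kernel P \<pi>B)"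
    and stationary: "stationary_pmf (state_action_kernel P \<pi>B) \<nu>"
    and \<nu>_pos: "\<And>z. 0 < pmf \<nu> z"
    and Qstar: "soft_bellman r P \<gamma> lam Qstar = Qstar"
begin

text \<open>
  The action and the next state are kept in a single distribution on a finite type, so that one
  iteration of the algorithm is averaged by one finite sum.
\<close>

definition transition :: "'s \<Rightarrow> ('a \<times> 's) pmf" where
  "transition s = bind_pmf (\<pi>B s) (\<lambda>a. map_pmf (Pair a) (P s a))"

lemma transition_mean:
  "(\<Sum>x\<in>UNIV. pmf (transition s) x * F x)
    = (\<Sum>a\<in>UNIV. pmf (\<pi>B s) a * (\<Sum>s'\<in>UNIV. pmf (P s a) s' * F (a, s')))"
proof -
  have "measure_pmf.expectation (transition s) F
    = (\<Sum>a\<in>UNIV. pmf (\<pi>B s) a * (\<Sum>s'\<in>UNIV. pmf (P s a) s' * F (a, s')))"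
    unfolding transition_def
    by (subst pmf_expectation_bind[of UNIV]) (auto simp: expectation_finite_type sum_pmf_map_Pair)
  then show ?thesis by (simp add: expectation_finite_type)
qed

lemma soft_Q_learning_Suc:
  "soft_Q_learning r P \<gamma> lam \<pi>B s0 \<alpha> (Suc t) =
    bind_pmf (soft_Q_learning r P \<gamma> lam \<pi>B s0 \<alpha> t) (\<lambda>(Q, s).
      map_pmf (\<lambda>(a, s'). (soft_Q_update r \<gamma> lam (\<alpha> t) s a s' Q, s')) (transition s))"
  by (simp add: transition_def map_bind_pmf pmf.map_comp o_def)

text \<open>
  The Poisson equation for the state-action chain, averaged over the action: the algorithm carries
  the current state only, the action being drawn afresh in each iteration. Solutions are determined up
  to a constant, which is used to make \<open>h\<close> nonnegative.
\<close>

lemma corrector_exists: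
  fixes f :: "'s \<times> 'a \<Rightarrow> real"
  obtains h :: "'s \<Rightarrow> real" where "\<And>s. 0 \<le> h s"
    and "\<And>s. (\<Sum>x\<in>UNIV. pmf (transition s) x * h (snd x)) - h s
          = (\<Sum>z\<in>UNIV. pmf \<nu> z * f z) - (\<Sum>a\<in>UNIV. pmf (\<pi>B s) a * f (s, a))"
proof -
  let ?K = "state_action_kernel P \<pi>B"
  obtain g where g: "\<And>z. g z - (\<Sum>z'\<in>UNIV. pmf (?K z) z' * g z') = f z - (\<Sum>z\<in>UNIV. pmf \<nu> z * f z)"
    using poisson_equation[OF irreducible stationary, of f] by blast
  define h0 where "h0 s = (\<Sum>a\<in>UNIV. pmf (\<pi>B s) a * g (s, a))" for s
  define m where "m = Min (range h0)"
  have m: "m \<le> h0 s" for s by (simp add: m_def)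
  have "(\<Sum>x\<in>UNIV. pmf (transition s) x * (h0 (snd x) - m)) - (h0 s - m)
    = (\<Sum>z\<in>UNIV. pmf \<nu> z * f z) - (\<Sum>a\<in>UNIV. pmf (\<pi>B s) a * f (s, a))" for s
  proof -
    have "(\<Sum>x\<in>UNIV. pmf (transition s) x * h0 (snd x)) = (\<Sum>a\<in>UNIV. pmf (\<pi>B s) a * kernel_mean ?K g (s, a))"
      by (simp add: transition_mean kernel_mean_state_action h0_def)
    also have "\<dots> = (\<Sum>a\<in>UNIV. pmf (\<pi>B s) a * (g (s, a) - f (s, a) + (\<Sum>z\<in>UNIV. pmf \<nu> z * f z)))"
    proof (intro sum.cong refl arg_cong2[where f = "(*)"])
      fix a
      show "kernel_mean ?K g (s, a) = g (s, a) - f (s, a) + (\<Sum>z\<in>UNIV. pmf \<nu> z * f z)"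
        using g[of "(s, a)"] by (simp add: kernel_mean_def)
    qed
    also have "\<dots> = h0 s - (\<Sum>a\<in>UNIV. pmf (\<pi>B s) a * f (s, a)) + (\<Sum>z\<in>UNIV. pmf \<nu> z * f z)"
      by (simp add: h0_def ring_distribs sum.distrib sum_subtractf pmf_mean_const)
    finally show ?thesis
      by (simp add: right_diff_distrib sum_subtractf pmf_mean_const)
  qed
  then show thesis using m by (intro that[of "\<lambda>s. h0 s - m"]) auto
qed

definition error :: "('s \<Rightarrow> 'a \<Rightarrow> real) \<Rightarrow> 's \<times> 'a \<Rightarrow> real" where
  "error Q = (\<lambda>(s, a). Q s a - Qstar s a)"

definition td_error :: "('s \<Rightarrow> 'a \<Rightarrow> real) \<Rightarrow> 's \<Rightarrow> 'a \<Rightarrow> 's \<Rightarrow> real" where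
  "td_error Q s a s' = r s a + \<gamma> * soft_maximum lam (Q s') - Q s a"

lemma error_update:
  "error (soft_Q_update r \<gamma> lam \<alpha> s a s' Q) =
    (error Q)((s, a) := error Q (s, a) + \<alpha> * td_error Q s a s')"
  by (auto simp: fun_eq_iff error_def soft_Q_update_def td_error_def soft_maximum_def)

lemma td_error_mean:
  "(\<Sum>s'\<in>UNIV. pmf (P s a) s' * td_error Q s a s') = soft_bellman r P \<gamma> lam Q s a - Q s a"
proof -
  have "(\<Sum>s'\<in>UNIV. pmf (P s a) s' * (\<gamma> * soft_maximum lam (Q s')))
    = \<gamma> * (\<Sum>s'\<in>UNIV. pmf (P s a) s' * soft_maximum lam (Q s'))"
    by (simp add: sum_distrib_left mult_ac)
  then show ?thesis
    by (simp add: td_error_def soft_bellman_def ring_distribs sum.distrib sum_subtractf pmf_mean_const)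
qed

lemma error_sup_norm:
  obtains N where "0 \<le> N" "\<And>z. \<bar>error Q z\<bar> \<le> N" "N ^ (2 * n + 2) \<le> (\<Sum>z\<in>UNIV. error Q z ^ (2 * n + 2))"
proof -
  define N where "N = Max (range (\<lambda>z. \<bar>error Q z\<bar>))"
  have le: "\<bar>error Q z\<bar> \<le> N" for z by (simp add: N_def)
  have "N \<in> range (\<lambda>z. \<bar>error Q z\<bar>)" unfolding N_def by (rule Max_in) auto
  then obtain z0 where z0: "N = \<bar>error Q z0\<bar>" by auto
  then have "N ^ (2 * n + 2) = error Q z0 ^ (2 * n + 2)" by (simp add: power_even_abs)
  also have "\<dots> \<le> (\<Sum>z\<in>UNIV. error Q z ^ (2 * n + 2))"
    by (intro member_le_sum zero_le_even_power) auto
  finally show thesis using that[of N] le z0 by auto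
qed

text \<open>
  The mean temporal difference error is the image of the error under the contraction minus the
  error itself. The resulting bound is linear in the powers \<open>error Q z ^ (2 * n + 2)\<close>, with
  coefficients that do not depend on \<open>Q\<close>; this is what allows a fixed finite family of Poisson
  equations to treat all tables at once.
\<close>

lemma td_drift:
  fixes Q :: "'s \<Rightarrow> 'a \<Rightarrow> real"
  shows "real (2 * n + 2) * (\<Sum>s'\<in>UNIV. pmf (P s a) s' * td_error Q s a s') * error Q (s, a) ^ (2 * n + 1)
    \<le> - (real (2 * n + 2) - \<gamma> * real (2 * n + 1)) * error Q (s, a) ^ (2 * n + 2)
      + \<gamma> * (\<Sum>z\<in>UNIV. error Q z ^ (2 * n + 2))"
proof -
  obtain N where N0: "0 \<le> N" and le: "\<And>z. \<bar>error Q z\<bar> \<le> N"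
    and N_le: "N ^ (2 * n + 2) \<le> (\<Sum>z\<in>UNIV. error Q z ^ (2 * n + 2))"
    using error_sup_norm[of Q n] by blast
  define G where "G = soft_bellman r P \<gamma> lam Q s a - soft_bellman r P \<gamma> lam Qstar s a"
  have "\<bar>Q s a - Qstar s a\<bar> \<le> N" for s a using le[of "(s, a)"] by (simp add: error_def)
  then have G: "\<bar>G\<bar> \<le> \<gamma> * N"
    unfolding G_def using \<gamma> lam by (intro soft_bellman_contraction) auto
  have td: "(\<Sum>s'\<in>UNIV. pmf (P s a) s' * td_error Q s a s') = G - error Q (s, a)"
    by (simp add: td_error_mean G_def Qstar error_def)
  have "real (2 * n + 2) * (G - error Q (s, a)) * error Q (s, a) ^ (2 * n + 1)
    \<le> - (real (2 * n + 2) - \<gamma> * real (2 * n + 1)) * error Q (s, a) ^ (2 * n + 2) + \<gamma> * N ^ (2 * n + 2)"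
    using G \<gamma> N0 by (intro power_drift_bound) auto
  also have "\<gamma> * N ^ (2 * n + 2) \<le> \<gamma> * (\<Sum>z\<in>UNIV. error Q z ^ (2 * n + 2))"
    using N_le \<gamma> by (intro mult_left_mono) auto
  finally show ?thesis unfolding td by simp
qed

text \<open>
  The weights \<open>1 / pmf \<nu> z\<close> compensate for the frequency with which the entry \<open>z\<close> is updated. The
  corrector \<open>h\<close>, scaled by the current step size \<open>\<kappa>\<close>, makes up for the difference between the current
  state and a stationary one.
\<close>

definition lyapunov :: "nat \<Rightarrow> ('s \<times> 'a \<Rightarrow> 's \<Rightarrow> real) \<Rightarrow> real \<Rightarrow> ('s \<Rightarrow> 'a \<Rightarrow> real) \<Rightarrow> 's \<Rightarrow> real" where
  "lyapunov n h \<kappa> Q s = (\<Sum>z\<in>UNIV. error Q z ^ (2 * n + 2) * (1 / pmf \<nu> z + \<kappa> * h z s))"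

text \<open>
  First order expansion in the step size along one transition. The corrector carries a factor \<open>\<alpha>'\<close>,
  so its interaction with the change of the updated entry is of second order; the correctors are
  nonnegative and the step sizes decrease, so passing from \<open>\<alpha>\<close> to \<open>\<alpha>'\<close> can only help.
\<close>

lemma lyapunov_update_le:
  assumes step: "0 \<le> \<alpha>'" "\<alpha>' \<le> \<alpha>" "\<alpha> \<le> 1"
    and D: "\<bar>error Q (s, a)\<bar> \<le> D" and E: "\<bar>td_error Q s a s'\<bar> \<le> E"
    and h: "\<And>z s. 0 \<le> h z s" "\<And>z s. h z s \<le> H" and W: "\<And>z. 1 / pmf \<nu> z \<le> W"
  shows "lyapunov n h \<alpha>' (soft_Q_update r \<gamma> lam \<alpha> s a s' Q) s' \<le> lyapunov n h \<alpha> Q s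
    + \<alpha> * (real (2 * n + 2) * td_error Q s a s' * error Q (s, a) ^ (2 * n + 1) / pmf \<nu> (s, a)
           + (\<Sum>z\<in>UNIV. error Q z ^ (2 * n + 2) * (h z s' - h z s)))
    + (W * (1 + E) ^ (2 * n + 2) + H * (real (2 * n + 2) * E * D + (1 + E) ^ (2 * n + 2)))
      * (\<alpha>\<^sup>2 * (error Q (s, a) ^ (2 * n) + \<alpha> ^ (2 * n)))"
proof -
  define x where "x = error Q (s, a)"
  define e where "e = td_error Q s a s'"
  define p where "p = real (2 * n + 2)"
  define A where "A = (1 + E) ^ (2 * n + 2)"
  define B where "B = \<alpha>\<^sup>2 * (x ^ (2 * n) + \<alpha> ^ (2 * n))"
  define w where "w = 1 / pmf \<nu> (s, a)"
  define d where "d = (x + \<alpha> * e) ^ (2 * n + 2) - x ^ (2 * n + 2)"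
  let ?y = "\<lambda>z. error Q z ^ (2 * n + 2)"
  have E0: "0 \<le> E" using E by linarith
  have D0: "0 \<le> D" using D by linarith
  have H0: "0 \<le> H" using h order_trans by blast
  have \<alpha>: "0 \<le> \<alpha>" using step by simp
  have p0: "0 \<le> p" by (simp add: p_def)
  have A0: "0 \<le> A" using E0 by (simp add: A_def)
  have x2n: "\<bar>x\<bar> ^ (2 * n) = x ^ (2 * n)" by (simp add: power_even_abs)
  have B0: "0 \<le> B" using \<alpha> by (simp add: B_def power_mult)
  have w: "0 \<le> w" "w \<le> W" using W by (auto simp: w_def)
  have taylor: "\<bar>d - p * (\<alpha> * e) * x ^ (2 * n + 1)\<bar> \<le> A * B"
    using power_taylor_bound[OF \<alpha> E, of x "2 * n"] by (simp add: d_def p_def e_def A_def B_def x2n mult.assoc)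
  have d_abs: "\<alpha>' * \<bar>d\<bar> \<le> (p * E * D + A) * B"
  proof -
    have "\<bar>p * (\<alpha> * e) * x ^ (2 * n + 1)\<bar> = p * \<alpha> * \<bar>e\<bar> * (\<bar>x\<bar> * x ^ (2 * n))"
      using p0 \<alpha> by (simp add: abs_mult power_abs x2n)
    also have "\<dots> \<le> p * \<alpha> * E * (D * x ^ (2 * n))"
      using p0 \<alpha> E D E0 D0 by (intro mult_mono mult_nonneg_nonneg) (auto simp: e_def x_def power_mult)
    finally have "\<bar>d\<bar> \<le> p * \<alpha> * E * (D * x ^ (2 * n)) + A * B" using taylor by linarith
    then have "\<alpha>' * \<bar>d\<bar> \<le> \<alpha> * (p * \<alpha> * E * (D * x ^ (2 * n)) + A * B)"
      using step \<alpha> by (intro mult_mono) auto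
    also have "\<dots> = p * E * D * (\<alpha>\<^sup>2 * x ^ (2 * n)) + \<alpha> * (A * B)"
      by (simp add: power2_eq_square algebra_simps)
    also have "\<dots> \<le> p * E * D * B + 1 * (A * B)"
    proof (intro add_mono mult_left_mono mult_right_mono)
      show "\<alpha>\<^sup>2 * x ^ (2 * n) \<le> B" using \<alpha> by (simp add: B_def algebra_simps)
    qed (use step p0 E0 D0 A0 B0 in auto)
    finally show ?thesis by (simp add: algebra_simps)
  qed
  \<comment> \<open>Only the entry \<open>(s, a)\<close> changes, and its power changes by \<open>d\<close>.\<close>
  have upd: "error (soft_Q_update r \<gamma> lam \<alpha> s a s' Q) z ^ (2 * n + 2) = ?y z + (if z = (s, a) then d else 0)" for z
    by (simp add: error_update d_def x_def e_def)
  have "lyapunov n h \<alpha>' (soft_Q_update r \<gamma> lam \<alpha> s a s' Q) s'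
    = (\<Sum>z\<in>UNIV. ?y z * (1 / pmf \<nu> z + \<alpha>' * h z s')) + d * (w + \<alpha>' * h (s, a) s')"
  proof -
    have "(\<Sum>z\<in>UNIV. (if z = (s, a) then d else 0) * (1 / pmf \<nu> z + \<alpha>' * h z s'))
      = (\<Sum>z\<in>UNIV. if z = (s, a) then d * (1 / pmf \<nu> z + \<alpha>' * h z s') else 0)"
      by (intro sum.cong) auto
    also have "\<dots> = d * (w + \<alpha>' * h (s, a) s')" by (simp add: w_def)
    finally show ?thesis unfolding lyapunov_def upd by (simp only: distrib_right sum.distrib)
  qed
  also have "(\<Sum>z\<in>UNIV. ?y z * (1 / pmf \<nu> z + \<alpha>' * h z s')) \<le> (\<Sum>z\<in>UNIV. ?y z * (1 / pmf \<nu> z + \<alpha> * h z s'))"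
    using step h by (intro sum_mono mult_left_mono add_left_mono mult_right_mono zero_le_even_power) auto
  also have "\<dots> = lyapunov n h \<alpha> Q s + \<alpha> * (\<Sum>z\<in>UNIV. ?y z * (h z s' - h z s))"
    by (simp add: lyapunov_def sum_distrib_left algebra_simps flip: sum.distrib sum_subtractf)
  also have "d * (w + \<alpha>' * h (s, a) s') \<le> \<alpha> * (p * e * x ^ (2 * n + 1) * w) + (W * A + H * (p * E * D + A)) * B"
  proof -
    have "w * (d - p * (\<alpha> * e) * x ^ (2 * n + 1)) \<le> w * (A * B)"
      using taylor w by (intro mult_left_mono) auto
    also have "\<dots> \<le> W * (A * B)" using w A0 B0 by (intro mult_right_mono) auto
    finally have "w * d \<le> \<alpha> * (p * e * x ^ (2 * n + 1) * w) + W * (A * B)"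
      by (simp add: algebra_simps)
    moreover have "d * (\<alpha>' * h (s, a) s') \<le> H * ((p * E * D + A) * B)"
    proof -
      have "d * (\<alpha>' * h (s, a) s') \<le> h (s, a) s' * (\<alpha>' * \<bar>d\<bar>)"
        using step h mult_right_mono[OF abs_ge_self, of "\<alpha>' * h (s, a) s'" d] by (simp add: mult_ac)
      also have "\<dots> \<le> H * ((p * E * D + A) * B)"
        by (rule mult_mono) (use h d_abs step H0 in auto)
      finally show ?thesis .
    qed
    ultimately show ?thesis by (simp add: algebra_simps)
  qed
  finally show ?thesis
    unfolding x_def[symmetric] e_def[symmetric] p_def[symmetric] A_def[symmetric] B_def[symmetric]
    by (simp add: w_def distrib_left)
qed

lemma lyapunov_ge:
  assumes "0 \<le> \<kappa>" and h: "\<And>z s. 0 \<le> h z s"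
  shows "(\<Sum>z\<in>UNIV. error Q z ^ (2 * n + 2)) \<le> lyapunov n h \<kappa> Q s"
proof -
  have "error Q z ^ (2 * n + 2) * 1 \<le> error Q z ^ (2 * n + 2) * (1 / pmf \<nu> z + \<kappa> * h z s)" for z
  proof (intro mult_left_mono zero_le_even_power)
    have "1 \<le> 1 / pmf \<nu> z" using \<nu>_pos[of z] by (simp add: pmf_le_1)
    moreover have "0 \<le> \<kappa> * h z s" using assms by (rule mult_nonneg_nonneg)
    ultimately show "1 \<le> 1 / pmf \<nu> z + \<kappa> * h z s" by linarith
  qed auto
  then show ?thesis
    unfolding lyapunov_def mult_1_right by (intro sum_mono)
qed

lemma lyapunov_le:
  assumes "0 \<le> \<kappa>" "\<kappa> \<le> 1" and h: "\<And>z s. 0 \<le> h z s" "\<And>z s. h z s \<le> H" and W: "\<And>z. 1 / pmf \<nu> z \<le> W"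
  shows "lyapunov n h \<kappa> Q s \<le> (W + H) * (\<Sum>z\<in>UNIV. error Q z ^ (2 * n + 2))"
proof -
  have "error Q z ^ (2 * n + 2) * (1 / pmf \<nu> z + \<kappa> * h z s) \<le> error Q z ^ (2 * n + 2) * (W + H)" for z
  proof (intro mult_left_mono zero_le_even_power)
    have "\<kappa> * h z s \<le> 1 * H" by (rule mult_mono) (use assms(1,2) h in auto)
    then show "1 / pmf \<nu> z + \<kappa> * h z s \<le> W + H" using W[of z] by linarith
  qed auto
  then show ?thesis
    unfolding lyapunov_def sum_distrib_left mult.commute[of "W + H"] by (intro sum_mono)
qed

text \<open>
  The stationary drift of the weighted sum of powers: the power of an entry decays at
  the rate \<open>2 * n + 2 - \<gamma> * (2 * n + 1)\<close> and feeds \<open>\<gamma>\<close> into each of the entries.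
\<close>

definition drift_rate :: "nat \<Rightarrow> real" where
  "drift_rate n = real (2 * n + 2) - \<gamma> * real (2 * n + 1) - \<gamma> * real CARD('s \<times> 'a)"

text \<open>
  By \<open>td_drift\<close>, the first order drift is bounded by a linear function of the powers, in which the
  power of the entry \<open>z\<close> has the coefficient \<open>f z\<close>, a function of the current pair. The corrector for \<open>f z\<close> trades this coefficient for its stationary
  mean, which is the same for all \<open>z\<close>.
\<close>

lemma correctors_exist:
  obtains h H where "\<And>z s. 0 \<le> h z s" "\<And>z s. h z s \<le> H"
    and "\<And>Q s. (\<Sum>x\<in>UNIV. pmf (transition s) x *
        (real (2 * n + 2) * td_error Q s (fst x) (snd x) * error Q (s, fst x) ^ (2 * n + 1) / pmf \<nu> (s, fst x)
           + (\<Sum>z\<in>UNIV. error Q z ^ (2 * n + 2) * (h z (snd x) - h z s))))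
      \<le> - drift_rate n * (\<Sum>z\<in>UNIV. error Q z ^ (2 * n + 2))"
proof -
  define c where "c = real (2 * n + 2) - \<gamma> * real (2 * n + 1)"
  define f where "f z z' = (\<gamma> - (if z' = z then c else 0)) / pmf \<nu> z'" for z z' :: "'s \<times> 'a"
  have \<nu>_f: "(\<Sum>z'\<in>UNIV. pmf \<nu> z' * f z z') = - drift_rate n" for z
  proof -
    have "(\<Sum>z'\<in>UNIV. pmf \<nu> z' * f z z') = (\<Sum>z'\<in>UNIV. \<gamma> - (if z' = z then c else 0))"
      using \<nu>_pos by (intro sum.cong) (auto simp: f_def less_le)
    also have "\<dots> = - drift_rate n" by (simp add: sum_subtractf c_def drift_rate_def)
    finally show ?thesis .
  qed
  have "\<exists>h. (\<forall>s. 0 \<le> h s) \<and> (\<forall>s. (\<Sum>x\<in>UNIV. pmf (transition s) x * h (snd x)) - h s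
      = - drift_rate n - (\<Sum>a\<in>UNIV. pmf (\<pi>B s) a * f z (s, a)))" for z
  proof -
    obtain h where "\<And>s. 0 \<le> h s"
      "\<And>s. (\<Sum>x\<in>UNIV. pmf (transition s) x * h (snd x)) - h s
        = - drift_rate n - (\<Sum>a\<in>UNIV. pmf (\<pi>B s) a * f z (s, a))"
      using corrector_exists[of "f z"] unfolding \<nu>_f by blast
    then show ?thesis by blast
  qed
  then have "\<exists>h. \<forall>z. (\<forall>s. 0 \<le> h z s) \<and> (\<forall>s. (\<Sum>x\<in>UNIV. pmf (transition s) x * h z (snd x)) - h z s
      = - drift_rate n - (\<Sum>a\<in>UNIV. pmf (\<pi>B s) a * f z (s, a)))"
    by (intro choice allI)
  then obtain h where h0: "\<And>z s. 0 \<le> h z s"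
    and h: "\<And>z s. (\<Sum>x\<in>UNIV. pmf (transition s) x * h z (snd x)) - h z s
      = - drift_rate n - (\<Sum>a\<in>UNIV. pmf (\<pi>B s) a * f z (s, a))"
    by blast
  have drift: "(\<Sum>x\<in>UNIV. pmf (transition s) x *
        (real (2 * n + 2) * td_error Q s (fst x) (snd x) * error Q (s, fst x) ^ (2 * n + 1) / pmf \<nu> (s, fst x)
           + (\<Sum>z\<in>UNIV. error Q z ^ (2 * n + 2) * (h z (snd x) - h z s))))
      \<le> - drift_rate n * (\<Sum>z\<in>UNIV. error Q z ^ (2 * n + 2))" for Q s
  proof -
    let ?y = "\<lambda>z. error Q z ^ (2 * n + 2)"
    let ?S = "\<Sum>z\<in>UNIV. ?y z"
    have "(\<Sum>x\<in>UNIV. pmf (transition s) x *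
        (real (2 * n + 2) * td_error Q s (fst x) (snd x) * error Q (s, fst x) ^ (2 * n + 1) / pmf \<nu> (s, fst x)))
      = (\<Sum>a\<in>UNIV. pmf (\<pi>B s) a *
          (real (2 * n + 2) * (\<Sum>s'\<in>UNIV. pmf (P s a) s' * td_error Q s a s') * error Q (s, a) ^ (2 * n + 1) / pmf \<nu> (s, a)))"
      proof -
      have "(\<Sum>s'\<in>UNIV. pmf (P s a) s' * (real (2 * n + 2) * td_error Q s a s' * error Q (s, a) ^ (2 * n + 1) / pmf \<nu> (s, a)))
        = real (2 * n + 2) * (\<Sum>s'\<in>UNIV. pmf (P s a) s' * td_error Q s a s') * error Q (s, a) ^ (2 * n + 1) / pmf \<nu> (s, a)" for a
        unfolding sum_distrib_left sum_distrib_right sum_divide_distrib by (intro sum.cong) simp_all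
      then show ?thesis unfolding transition_mean by simp
    qed
    also have "\<dots> \<le> (\<Sum>a\<in>UNIV. pmf (\<pi>B s) a * ((- c * ?y (s, a) + \<gamma> * ?S) / pmf \<nu> (s, a)))"
      using td_drift[of n s _ Q] unfolding c_def by (intro pmf_mean_mono divide_right_mono) auto
    also have "\<dots> = (\<Sum>a\<in>UNIV. pmf (\<pi>B s) a * (\<Sum>z\<in>UNIV. ?y z * f z (s, a)))"
    proof (intro sum.cong refl arg_cong2[where f = "(*)"])
      fix a :: 'a
      have "(\<Sum>z\<in>UNIV. ?y z * f z (s, a)) = (\<Sum>z\<in>UNIV. ?y z * \<gamma> - (if (s, a) = z then ?y z * c else 0)) / pmf \<nu> (s, a)"
        unfolding sum_divide_distrib by (intro sum.cong) (auto simp: f_def algebra_simps)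
      also have "\<dots> = (?S * \<gamma> - ?y (s, a) * c) / pmf \<nu> (s, a)"
        by (simp add: sum_subtractf flip: sum_distrib_right)
      finally show "(- c * ?y (s, a) + \<gamma> * ?S) / pmf \<nu> (s, a) = (\<Sum>z\<in>UNIV. ?y z * f z (s, a))"
        by (simp add: mult.commute)
    qed
    also have "\<dots> = (\<Sum>z\<in>UNIV. ?y z * (\<Sum>a\<in>UNIV. pmf (\<pi>B s) a * f z (s, a)))"
      unfolding sum_distrib_left by (subst sum.swap) (simp add: mult.left_commute)
    finally have main: "(\<Sum>x\<in>UNIV. pmf (transition s) x *
        (real (2 * n + 2) * td_error Q s (fst x) (snd x) * error Q (s, fst x) ^ (2 * n + 1) / pmf \<nu> (s, fst x)))
      \<le> (\<Sum>z\<in>UNIV. ?y z * (\<Sum>a\<in>UNIV. pmf (\<pi>B s) a * f z (s, a)))" .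
    have "(\<Sum>x\<in>UNIV. pmf (transition s) x * (\<Sum>z\<in>UNIV. ?y z * (h z (snd x) - h z s)))
      = (\<Sum>z\<in>UNIV. ?y z * (\<Sum>x\<in>UNIV. pmf (transition s) x * (h z (snd x) - h z s)))"
      unfolding sum_distrib_left by (subst sum.swap) (simp add: mult.left_commute)
    also have "\<dots> = (\<Sum>z\<in>UNIV. ?y z * ((\<Sum>x\<in>UNIV. pmf (transition s) x * h z (snd x)) - h z s))"
      by (simp only: right_diff_distrib sum_subtractf pmf_mean_const)
    also have "\<dots> = - drift_rate n * ?S - (\<Sum>z\<in>UNIV. ?y z * (\<Sum>a\<in>UNIV. pmf (\<pi>B s) a * f z (s, a)))"
      unfolding h by (simp only: right_diff_distrib sum_subtractf flip: sum_distrib_right) simp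
    finally show ?thesis
      using main by (simp only: distrib_left sum.distrib)
  qed
  define H where "H = Max (range (\<lambda>(z, s). h z s))"
  have "h z s \<le> H" for z s unfolding H_def by (rule Max_ge) auto
  then show thesis using h0 drift that by blast
qed

text \<open>
  Half of the drift absorbs the second order terms, and the other half remains. The same
  \<open>\<kappa>\<close>, \<open>C\<close> and \<open>h\<close> serve all tables within the bounds \<open>D\<close> and \<open>E\<close> and all step sizes, so that the
  inequality can be iterated.
\<close>

lemma lyapunov_drift_exists:
  assumes rate: "0 < drift_rate n" and "0 \<le> D" "0 \<le> E"
  obtains \<kappa> C h where "0 < \<kappa>" "0 \<le> C"
    and "\<And>z s. 0 \<le> h z s"
    and "\<And>\<alpha> \<alpha>' Q s. \<lbrakk>0 \<le> \<alpha>'; \<alpha>' \<le> \<alpha>; \<alpha> \<le> 1; \<forall>z. \<bar>error Q z\<bar> \<le> D; \<forall>s a s'. \<bar>td_error Q s a s'\<bar> \<le> E\<rbrakk> \<Longrightarrow>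
      (\<Sum>x\<in>UNIV. pmf (transition s) x * lyapunov n h \<alpha>' (soft_Q_update r \<gamma> lam \<alpha> s (fst x) (snd x) Q) (snd x))
      \<le> (1 - \<kappa> * \<alpha>) * lyapunov n h \<alpha> Q s + C * \<alpha> ^ (n + 2)"
proof -
  obtain h H where h: "\<And>z s. 0 \<le> h z s" "\<And>z s. h z s \<le> H"
    and drift: "\<And>Q s. (\<Sum>x\<in>UNIV. pmf (transition s) x *
        (real (2 * n + 2) * td_error Q s (fst x) (snd x) * error Q (s, fst x) ^ (2 * n + 1) / pmf \<nu> (s, fst x)
           + (\<Sum>z\<in>UNIV. error Q z ^ (2 * n + 2) * (h z (snd x) - h z s))))
      \<le> - drift_rate n * (\<Sum>z\<in>UNIV. error Q z ^ (2 * n + 2))"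
    using correctors_exist[of n] by blast
  have H0: "0 \<le> H" using h order_trans by blast
  define W where "W = Max (range (\<lambda>z. 1 / pmf \<nu> z))"
  have W: "1 / pmf \<nu> z \<le> W" for z by (simp add: W_def)
  have W1: "1 \<le> W"
  proof -
    have "1 \<le> 1 / pmf \<nu> undefined" using \<nu>_pos[of undefined] by (simp add: pmf_le_1)
    then show ?thesis using W[of undefined] by linarith
  qed
  define C where "C = W * (1 + E) ^ (2 * n + 2) + H * (real (2 * n + 2) * E * D + (1 + E) ^ (2 * n + 2))"
  have "1 * 1 \<le> W * (1 + E) ^ (2 * n + 2)"
    using W1 assms(3) by (intro mult_mono one_le_power) auto
  moreover have "0 \<le> H * (real (2 * n + 2) * E * D + (1 + E) ^ (2 * n + 2))"
    using H0 assms by simp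
  ultimately have C: "0 < C" unfolding C_def by linarith
  \<comment> \<open>With this choice, absorbing \<open>C\<close> times the noise costs half of the drift.\<close>
  define \<epsilon> where "\<epsilon> = drift_rate n / (2 * C)"
  have \<epsilon>: "0 < \<epsilon>" using rate C by (simp add: \<epsilon>_def)
  define C' where "C' = C * (1 / \<epsilon> ^ n + 1)"
  define \<kappa> where "\<kappa> = drift_rate n / (2 * (W + H))"
  have \<kappa>: "0 < \<kappa>" using rate W1 H0 by (simp add: \<kappa>_def)
  have "(\<Sum>x\<in>UNIV. pmf (transition s) x * lyapunov n h \<alpha>' (soft_Q_update r \<gamma> lam \<alpha> s (fst x) (snd x) Q) (snd x))
      \<le> (1 - \<kappa> * \<alpha>) * lyapunov n h \<alpha> Q s + C' * \<alpha> ^ (n + 2)"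
    if step: "0 \<le> \<alpha>'" "\<alpha>' \<le> \<alpha>" "\<alpha> \<le> 1" and D: "\<forall>z. \<bar>error Q z\<bar> \<le> D" and E: "\<forall>s a s'. \<bar>td_error Q s a s'\<bar> \<le> E"
    for \<alpha> \<alpha>' Q s
  proof -
    define S where "S = (\<Sum>z\<in>UNIV. error Q z ^ (2 * n + 2))"
    define first_order where "first_order x =
        real (2 * n + 2) * td_error Q s (fst x) (snd x) * error Q (s, fst x) ^ (2 * n + 1) / pmf \<nu> (s, fst x)
           + (\<Sum>z\<in>UNIV. error Q z ^ (2 * n + 2) * (h z (snd x) - h z s))" for x
    have \<alpha>: "0 \<le> \<alpha>" using step by simp
    have y_le: "error Q z ^ (2 * n + 2) \<le> S" for z
      unfolding S_def by (intro member_le_sum zero_le_even_power) auto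
    have "lyapunov n h \<alpha>' (soft_Q_update r \<gamma> lam \<alpha> s (fst x) (snd x) Q) (snd x)
      \<le> (lyapunov n h \<alpha> Q s + \<alpha> * drift_rate n / 2 * S + C' * \<alpha> ^ (n + 2)) + \<alpha> * first_order x" for x
    proof -
      let ?x = "error Q (s, fst x)"
      have "\<alpha>\<^sup>2 * ?x ^ (2 * n) \<le> \<epsilon> * \<alpha> * ?x ^ (2 * n + 2) + \<alpha> ^ (n + 2) / \<epsilon> ^ n"
        by (rule noise_absorption[OF \<alpha> \<epsilon>])
      also have "\<epsilon> * \<alpha> * ?x ^ (2 * n + 2) \<le> \<epsilon> * \<alpha> * S"
        using \<epsilon> \<alpha> y_le by (intro mult_left_mono) auto
      finally have "\<alpha>\<^sup>2 * ?x ^ (2 * n) \<le> \<epsilon> * \<alpha> * S + \<alpha> ^ (n + 2) / \<epsilon> ^ n" by simp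
      moreover have "\<alpha>\<^sup>2 * \<alpha> ^ (2 * n) \<le> \<alpha> ^ (n + 2)"
        unfolding power_add[symmetric] using \<alpha> step(3) by (intro power_decreasing) auto
      ultimately have "\<alpha>\<^sup>2 * (?x ^ (2 * n) + \<alpha> ^ (2 * n)) \<le> \<epsilon> * \<alpha> * S + (1 / \<epsilon> ^ n + 1) * \<alpha> ^ (n + 2)"
        by (simp add: algebra_simps)
      then have "C * (\<alpha>\<^sup>2 * (?x ^ (2 * n) + \<alpha> ^ (2 * n))) \<le> C * (\<epsilon> * \<alpha> * S + (1 / \<epsilon> ^ n + 1) * \<alpha> ^ (n + 2))"
        using C by (intro mult_left_mono) auto
      also have "\<dots> = \<alpha> * drift_rate n / 2 * S + C' * \<alpha> ^ (n + 2)"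
      proof -
        have "C * \<epsilon> = drift_rate n / 2" using C by (simp add: \<epsilon>_def)
        moreover have "C * (\<epsilon> * \<alpha> * S + (1 / \<epsilon> ^ n + 1) * \<alpha> ^ (n + 2)) = (C * \<epsilon>) * \<alpha> * S + C' * \<alpha> ^ (n + 2)"
          unfolding C'_def distrib_left[of C "\<epsilon> * \<alpha> * S"] by (simp only: mult.assoc)
        ultimately show ?thesis by simp
      qed
      finally show ?thesis
        using lyapunov_update_le[where s = s and a = "fst x" and s' = "snd x" and n = n and h = h, OF step D[rule_format] E[rule_format] h W]
        unfolding first_order_def C_def by linarith
    qed
    then have "(\<Sum>x\<in>UNIV. pmf (transition s) x * lyapunov n h \<alpha>' (soft_Q_update r \<gamma> lam \<alpha> s (fst x) (snd x) Q) (snd x))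
      \<le> (\<Sum>x\<in>UNIV. pmf (transition s) x *
          ((lyapunov n h \<alpha> Q s + \<alpha> * drift_rate n / 2 * S + C' * \<alpha> ^ (n + 2)) + \<alpha> * first_order x))"
      by (rule pmf_mean_mono)
    also have "\<dots> = (lyapunov n h \<alpha> Q s + \<alpha> * drift_rate n / 2 * S + C' * \<alpha> ^ (n + 2))
        + (\<Sum>x\<in>UNIV. pmf (transition s) x * (\<alpha> * first_order x))"
      by (simp only: distrib_left[where b = "_ + _"] sum.distrib pmf_mean_const)
    also have "(\<Sum>x\<in>UNIV. pmf (transition s) x * (\<alpha> * first_order x))
        = \<alpha> * (\<Sum>x\<in>UNIV. pmf (transition s) x * first_order x)"
      by (simp add: sum_distrib_left mult_ac)
    also have "\<dots> \<le> \<alpha> * (- drift_rate n * S)"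
      using drift[of s Q] \<alpha> unfolding first_order_def S_def by (intro mult_left_mono) auto
    also have "lyapunov n h \<alpha> Q s + \<alpha> * drift_rate n / 2 * S + C' * \<alpha> ^ (n + 2) + \<alpha> * (- drift_rate n * S)
      = lyapunov n h \<alpha> Q s - \<kappa> * \<alpha> * ((W + H) * S) + C' * \<alpha> ^ (n + 2)"
      using W1 H0 by (simp add: \<kappa>_def field_simps)
    also have "\<dots> \<le> lyapunov n h \<alpha> Q s - \<kappa> * \<alpha> * lyapunov n h \<alpha> Q s + C' * \<alpha> ^ (n + 2)"
      using lyapunov_le[where h = h and n = n and Q = Q and s = s, OF \<alpha> step(3) h W] \<kappa> \<alpha> unfolding S_def
      by (intro add_right_mono diff_left_mono mult_left_mono) auto
    finally show ?thesis by (simp add: algebra_simps)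
  qed
  moreover have "0 \<le> C'" using C \<epsilon> by (simp add: C'_def)
  ultimately show thesis using that[of \<kappa> C' h] \<kappa> h(1) by blast
qed

section \<open>Rate of convergence in mean square\<close>

lemma finite_set_soft_Q_learning:
  "finite (set_pmf (soft_Q_learning r P \<gamma> lam \<pi>B s0 \<alpha> t))"
  by (induction t) (auto simp del: soft_Q_learning.simps(2) simp: soft_Q_learning_Suc)

text \<open>
  For step sizes in \<open>[0, 1]\<close> the new entry is a convex combination of the old entry and the target, and
  the bound is the fixed point of \<open>B \<mapsto> R + \<gamma> * (B + lam * ln CARD('a))\<close>, which dominates the target.
\<close>

lemma soft_Q_learning_bounded:
  assumes R: "\<And>s a. \<bar>r s a\<bar> \<le> R" and \<alpha>: "\<And>t. 0 \<le> \<alpha> t" "\<And>t. \<alpha> t \<le> 1"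
    and "(Q, s) \<in> set_pmf (soft_Q_learning r P \<gamma> lam \<pi>B s0 \<alpha> t)"
  shows "\<bar>Q u b\<bar> \<le> (R + \<gamma> * lam * ln (real CARD('a))) / (1 - \<gamma>)"
proof -
  define B where "B = (R + \<gamma> * lam * ln (real CARD('a))) / (1 - \<gamma>)"
  have B: "R + \<gamma> * (B + lam * ln (real CARD('a))) = B" using \<gamma> by (simp add: B_def field_simps)
  have "0 \<le> R" using R[of undefined undefined] by linarith
  moreover have "0 \<le> lam * ln (real CARD('a))" using lam by (simp add: Suc_leI)
  ultimately have B0: "0 \<le> B" using \<gamma> by (simp add: B_def mult.assoc)
  show ?thesis
    using assms(4) unfolding B_def[symmetric]
  proof (induction t arbitrary: Q s u b)
    case 0
    then show ?case using B0 by simp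
  next
    case (Suc t)
    from Suc.prems obtain Q' s' a where Q': "(Q', s') \<in> set_pmf (soft_Q_learning r P \<gamma> lam \<pi>B s0 \<alpha> t)"
      and Q: "Q = soft_Q_update r \<gamma> lam (\<alpha> t) s' a s Q'"
      unfolding soft_Q_learning_Suc by auto
    have IH: "\<bar>Q' u b\<bar> \<le> B" for u b using Suc.IH[OF Q'] .
    have target: "\<bar>r s' a + \<gamma> * soft_maximum lam (Q' s)\<bar> \<le> B"
    proof -
      have "\<bar>\<gamma> * soft_maximum lam (Q' s)\<bar> \<le> \<gamma> * (B + lam * ln (real CARD('a)))"
        using soft_maximum_bound[OF lam, of "Q' s" B] IH \<gamma> by (simp add: abs_mult mult_left_mono)
      then show ?thesis using R[of s' a] B by linarith
    qed
    have "\<bar>(1 - \<alpha> t) * Q' s' a + \<alpha> t * (r s' a + \<gamma> * soft_maximum lam (Q' s))\<bar>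
      \<le> (1 - \<alpha> t) * B + \<alpha> t * B"
      using \<alpha>[of t] IH[of s' a] target
      by (intro order_trans[OF abs_triangle_ineq] add_mono) (simp_all add: abs_mult mult_left_mono)
    also have "(1 - \<alpha> t) * Q' s' a + \<alpha> t * (r s' a + \<gamma> * soft_maximum lam (Q' s)) = Q s' a"
      by (simp add: Q soft_Q_update_def soft_maximum_def algebra_simps)
    also have "(1 - \<alpha> t) * B + \<alpha> t * B = B" by (simp add: left_diff_distrib)
    finally show ?case using IH[of u b] by (auto simp: Q soft_Q_update_def split: if_splits)
  qed
qed

lemma policy_error_le:
  assumes c: "0 < c"
  shows "(policy_dist (softmax_policy lam Qstar) (softmax_policy lam Q))\<^sup>2
    \<le> (2 / lam)\<^sup>2 * (c + (\<Sum>z\<in>UNIV. error Q z ^ (2 * n + 2)) / c ^ n)"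
proof -
  obtain N where N: "0 \<le> N" "\<And>z. \<bar>error Q z\<bar> \<le> N" "N ^ (2 * n + 2) \<le> (\<Sum>z\<in>UNIV. error Q z ^ (2 * n + 2))"
    using error_sup_norm[of Q n] by blast
  have "\<bar>Qstar s a - Q s a\<bar> \<le> N" for s a
    using N(2)[of "(s, a)"] by (simp add: error_def abs_minus_commute)
  then have "policy_dist (softmax_policy lam Qstar) (softmax_policy lam Q) \<le> 2 / lam * N"
    using softmax_policy_dist_le[OF lam, of Qstar Q N] by simp
  then have "(policy_dist (softmax_policy lam Qstar) (softmax_policy lam Q))\<^sup>2 \<le> (2 / lam * N)\<^sup>2"
    using policy_dist_nonneg by (intro power_mono) auto
  also have "\<dots> = (2 / lam)\<^sup>2 * N\<^sup>2" by (rule power_mult_distrib)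
  also have "\<dots> \<le> (2 / lam)\<^sup>2 * (c + (N\<^sup>2) ^ (n + 1) / c ^ n)"
    by (intro mult_left_mono le_add_power_div c) auto
  also have "(N\<^sup>2) ^ (n + 1) = N ^ (2 * n + 2)"
    unfolding power_mult[symmetric] by (simp only: distrib_left mult_1_right)
  also have "(2 / lam)\<^sup>2 * (c + N ^ (2 * n + 2) / c ^ n) \<le> (2 / lam)\<^sup>2 * (c + (\<Sum>z\<in>UNIV. error Q z ^ (2 * n + 2)) / c ^ n)"
    using c by (intro mult_left_mono add_left_mono divide_right_mono N(3)) auto
  finally show ?thesis .
qed

lemma expectation_soft_Q_learning_Suc:
  fixes F :: "('s \<Rightarrow> 'a \<Rightarrow> real) \<times> 's \<Rightarrow> real"
  shows "measure_pmf.expectation (soft_Q_learning r P \<gamma> lam \<pi>B s0 \<alpha> (Suc t)) F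
    = measure_pmf.expectation (soft_Q_learning r P \<gamma> lam \<pi>B s0 \<alpha> t) (\<lambda>(Q, s).
        \<Sum>x\<in>UNIV. pmf (transition s) x * F (soft_Q_update r \<gamma> lam (\<alpha> t) s (fst x) (snd x) Q, snd x))"
proof -
  let ?p = "soft_Q_learning r P \<gamma> lam \<pi>B s0 \<alpha> t"
  have "measure_pmf.expectation (soft_Q_learning r P \<gamma> lam \<pi>B s0 \<alpha> (Suc t)) F
    = (\<Sum>y\<in>set_pmf ?p. pmf ?p y *\<^sub>R measure_pmf.expectation (case y of (Q, s) \<Rightarrow>
        map_pmf (\<lambda>(a, s'). (soft_Q_update r \<gamma> lam (\<alpha> t) s a s' Q, s')) (transition s)) F)"
    unfolding soft_Q_learning_Suc
    by (rule pmf_expectation_bind) (auto simp: finite_set_soft_Q_learning)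
  also have "\<dots> = (\<Sum>y\<in>set_pmf ?p. pmf ?p y *\<^sub>R (case y of (Q, s) \<Rightarrow>
        \<Sum>x\<in>UNIV. pmf (transition s) x * F (soft_Q_update r \<gamma> lam (\<alpha> t) s (fst x) (snd x) Q, snd x)))"
    by (intro sum.cong) (auto simp: expectation_finite_type case_prod_unfold)
  also have "\<dots> = measure_pmf.expectation ?p (\<lambda>(Q, s).
        \<Sum>x\<in>UNIV. pmf (transition s) x * F (soft_Q_update r \<gamma> lam (\<alpha> t) s (fst x) (snd x) Q, snd x))"
    by (rule integral_measure_pmf[symmetric]) (auto simp: finite_set_soft_Q_learning)
  finally show ?thesis .
qed

text \<open>
  The drift inequality is averaged over the law of the algorithm and iterated with step sizes
  \<open>a / (t + b)\<close>. The exponent is fixed first, large enough for a positive drift rate; \<open>a\<close> is then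
  tuned to the drift constant \<open>\<kappa>\<close>, and \<open>b\<close> keeps the step sizes below 1.
\<close>

lemma soft_Q_learning_mean_square_rate:
  assumes R: "\<And>s a. \<bar>r s a\<bar> \<le> R"
  obtains \<alpha> C where "\<And>t. 0 < \<alpha> t" "0 \<le> C"
    and "\<And>t. measure_pmf.expectation (soft_Q_learning_policy r P \<gamma> lam \<pi>B s0 \<alpha> t)
          (\<lambda>\<pi>o. (policy_dist (softmax_policy lam Qstar) \<pi>o)\<^sup>2) \<le> C / (real t + 1)"
proof -
  define B where "B = (R + \<gamma> * lam * ln (real CARD('a))) / (1 - \<gamma>)"
  define D where "D = B + Max (range (\<lambda>(s, a). \<bar>Qstar s a\<bar>))"
  define E where "E = R + \<gamma> * (B + lam * ln (real CARD('a))) + B"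
  have error_le: "\<bar>error Q z\<bar> \<le> D" if "\<And>s a. \<bar>Q s a\<bar> \<le> B" for Q z
  proof (cases z)
    case (Pair s a)
    have "\<bar>Qstar s a\<bar> \<le> Max (range (\<lambda>(s, a). \<bar>Qstar s a\<bar>))" by (rule Max_ge) auto
    then have "\<bar>Q s a - Qstar s a\<bar> \<le> D" using that[of s a] unfolding D_def by linarith
    then show ?thesis by (simp add: Pair error_def)
  qed
  have td_le: "\<bar>td_error Q s a s'\<bar> \<le> E" if "\<And>s a. \<bar>Q s a\<bar> \<le> B" for Q s a s'
  proof -
    have "\<bar>\<gamma> * soft_maximum lam (Q s')\<bar> \<le> \<gamma> * (B + lam * ln (real CARD('a)))"
      using soft_maximum_bound[OF lam, of "Q s'" B] that \<gamma> by (simp add: abs_mult mult_left_mono)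
    then show ?thesis using R[of s a] that[of s a] unfolding td_error_def E_def by linarith
  qed
  have B0: "0 \<le> B"
  proof -
    have "0 \<le> R" using R[of undefined undefined] by linarith
    moreover have "0 \<le> lam * ln (real CARD('a))" using lam by (simp add: Suc_leI)
    ultimately show ?thesis using \<gamma> by (simp add: B_def mult.assoc)
  qed
  have D0: "0 \<le> D" and E0: "0 \<le> E"
    using order_trans[OF abs_ge_zero error_le[of "\<lambda>_ _. 0" undefined]]
      order_trans[OF abs_ge_zero td_le[of "\<lambda>_ _. 0" undefined undefined undefined]] B0 by simp_all

  obtain n :: nat where n: "\<gamma> * real CARD('s \<times> 'a) / (1 - \<gamma>) < real n"
    using reals_Archimedean2 by blast
  have rate: "0 < drift_rate n"
  proof -
    have "\<gamma> * real CARD('s \<times> 'a) < real n * (1 - \<gamma>)"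
      using n \<gamma> by (simp add: pos_divide_less_eq)
    also have "\<dots> \<le> real (2 * n + 1) * (1 - \<gamma>)"
      using \<gamma> by (intro mult_right_mono) auto
    finally show ?thesis by (simp add: drift_rate_def algebra_simps)
  qed
  obtain \<kappa> C h where \<kappa>: "0 < \<kappa>" and C: "0 \<le> C" and h: "\<And>z s. 0 \<le> h z s"
    and drift: "\<And>\<alpha> \<alpha>' Q s. \<lbrakk>0 \<le> \<alpha>'; \<alpha>' \<le> \<alpha>; \<alpha> \<le> 1; \<forall>z. \<bar>error Q z\<bar> \<le> D; \<forall>s a s'. \<bar>td_error Q s a s'\<bar> \<le> E\<rbrakk> \<Longrightarrow>
      (\<Sum>x\<in>UNIV. pmf (transition s) x * lyapunov n h \<alpha>' (soft_Q_update r \<gamma> lam \<alpha> s (fst x) (snd x) Q) (snd x))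
      \<le> (1 - \<kappa> * \<alpha>) * lyapunov n h \<alpha> Q s + C * \<alpha> ^ (n + 2)"
    by (rule lyapunov_drift_exists[OF rate D0 E0]) blast

  define a where "a = (real n + 2) / \<kappa>"
  define b where "b = a + (real n + 2) + 1"
  define \<alpha> where "\<alpha> t = a / (real t + b)" for t
  have a: "0 < a" "\<kappa> * a = real n + 2" using \<kappa> by (simp_all add: a_def)
  have b: "1 \<le> b" "a \<le> b" "\<kappa> * a \<le> b" using a unfolding b_def by linarith+
  have \<alpha>: "0 < \<alpha> t" "\<alpha> t \<le> 1" "\<alpha> (Suc t) \<le> \<alpha> t" for t
  proof -
    have tb: "0 < real t + b" using b by linarith
    show "0 < \<alpha> t" unfolding \<alpha>_def using a tb by (intro divide_pos_pos)
    show "\<alpha> t \<le> 1" unfolding \<alpha>_def using b tb by simp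
    show "\<alpha> (Suc t) \<le> \<alpha> t"
      unfolding \<alpha>_def using a tb by (intro divide_left_mono mult_pos_pos) linarith+
  qed

  let ?p = "soft_Q_learning r P \<gamma> lam \<pi>B s0 \<alpha>"
  have integrable: "integrable (?p t) F" for t and F :: "_ \<Rightarrow> real"
    by (rule integrable_measure_pmf_finite[OF finite_set_soft_Q_learning])
  define v where "v t = measure_pmf.expectation (?p t) (\<lambda>(Q, s). lyapunov n h (\<alpha> t) Q s)" for t
  have "v (Suc t) \<le> (1 - \<kappa> * (a / (real t + b))) * v t + C * (a / (real t + b)) ^ ((n + 1) + 1)" for t
  proof -
    have "v (Suc t) = measure_pmf.expectation (?p t) (\<lambda>(Q, s).
        \<Sum>x\<in>UNIV. pmf (transition s) x * lyapunov n h (\<alpha> (Suc t)) (soft_Q_update r \<gamma> lam (\<alpha> t) s (fst x) (snd x) Q) (snd x))"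
      unfolding v_def expectation_soft_Q_learning_Suc by simp
    also have "\<dots> \<le> measure_pmf.expectation (?p t) (\<lambda>x. (1 - \<kappa> * \<alpha> t) * (case x of (Q, s) \<Rightarrow> lyapunov n h (\<alpha> t) Q s) + C * \<alpha> t ^ (n + 2))"
    proof (rule integral_mono_AE[OF integrable integrable])
      have "(\<Sum>x\<in>UNIV. pmf (transition s) x * lyapunov n h (\<alpha> (Suc t)) (soft_Q_update r \<gamma> lam (\<alpha> t) s (fst x) (snd x) Q) (snd x))
          \<le> (1 - \<kappa> * \<alpha> t) * lyapunov n h (\<alpha> t) Q s + C * \<alpha> t ^ (n + 2)"
        if "(Q, s) \<in> set_pmf (?p t)" for Q s
      proof -
        have Q: "\<bar>Q u b\<bar> \<le> B" for u b
          using soft_Q_learning_bounded[OF R _ _ that] \<alpha>(1,2) unfolding B_def by (simp add: less_imp_le)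
        show ?thesis
          by (rule drift) (use \<alpha>(1)[of "Suc t", THEN less_imp_le] \<alpha>(2,3) error_le[OF Q] td_le[OF Q] in auto)
      qed
      then show "AE x in measure_pmf (?p t). (case x of (Q, s) \<Rightarrow>
          \<Sum>x\<in>UNIV. pmf (transition s) x * lyapunov n h (\<alpha> (Suc t)) (soft_Q_update r \<gamma> lam (\<alpha> t) s (fst x) (snd x) Q) (snd x))
          \<le> (1 - \<kappa> * \<alpha> t) * (case x of (Q, s) \<Rightarrow> lyapunov n h (\<alpha> t) Q s) + C * \<alpha> t ^ (n + 2)"
        by (auto simp: AE_measure_pmf_iff)
    qed
    also have "\<dots> = (1 - \<kappa> * \<alpha> t) * v t + C * \<alpha> t ^ (n + 2)"
      unfolding v_def by (subst Bochner_Integration.integral_add) (auto intro: integrable)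
    finally show ?thesis by (simp add: \<alpha>_def)
  qed
  then obtain M where M: "\<And>t. v t \<le> M / (real t + b) ^ (n + 1)"
    by (rule harmonic_step_decay) (use a b C in auto)

  have rate: "measure_pmf.expectation (soft_Q_learning_policy r P \<gamma> lam \<pi>B s0 \<alpha> t)
          (\<lambda>\<pi>o. (policy_dist (softmax_policy lam Qstar) \<pi>o)\<^sup>2) \<le> (2 / lam)\<^sup>2 * (1 + max 0 M) / (real t + 1)" for t
  proof -
    \<comment> \<open>The expected size of the squared error, for which both terms of \<open>policy_error_le\<close> balance.\<close>
    define c where "c = 1 / (real t + b)"
    have c: "0 < c" using b by (simp add: c_def)
    have "measure_pmf.expectation (soft_Q_learning_policy r P \<gamma> lam \<pi>B s0 \<alpha> t)
          (\<lambda>\<pi>o. (policy_dist (softmax_policy lam Qstar) \<pi>o)\<^sup>2)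
      = measure_pmf.expectation (?p t) (\<lambda>(Q, s). (policy_dist (softmax_policy lam Qstar) (softmax_policy lam Q))\<^sup>2)"
      by (simp add: soft_Q_learning_policy_def case_prod_unfold)
    also have "\<dots> \<le> measure_pmf.expectation (?p t) (\<lambda>x. (2 / lam)\<^sup>2 * (c + (case x of (Q, s) \<Rightarrow> lyapunov n h (\<alpha> t) Q s) / c ^ n))"
    proof (rule integral_mono[OF integrable integrable])
      fix x :: "('s \<Rightarrow> 'a \<Rightarrow> real) \<times> 's"
      obtain Q s where x: "x = (Q, s)" by (cases x)
      have "(policy_dist (softmax_policy lam Qstar) (softmax_policy lam Q))\<^sup>2
        \<le> (2 / lam)\<^sup>2 * (c + (\<Sum>z\<in>UNIV. error Q z ^ (2 * n + 2)) / c ^ n)"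
        by (rule policy_error_le[OF c])
      also have "\<dots> \<le> (2 / lam)\<^sup>2 * (c + lyapunov n h (\<alpha> t) Q s / c ^ n)"
        using c \<alpha>(1)[of t, THEN less_imp_le] h
        by (intro mult_left_mono add_left_mono divide_right_mono lyapunov_ge) auto
      finally show "(case x of (Q, s) \<Rightarrow> (policy_dist (softmax_policy lam Qstar) (softmax_policy lam Q))\<^sup>2)
        \<le> (2 / lam)\<^sup>2 * (c + (case x of (Q, s) \<Rightarrow> lyapunov n h (\<alpha> t) Q s) / c ^ n)"
        by (simp add: x)
    qed
    also have "\<dots> = (2 / lam)\<^sup>2 * (c + v t / c ^ n)"
      unfolding v_def integral_mult_right_zero
      by (subst Bochner_Integration.integral_add) (auto intro: integrable)
    also have "\<dots> \<le> (2 / lam)\<^sup>2 * (c + (max 0 M * c ^ (n + 1)) / c ^ n)"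
    proof (intro mult_left_mono add_left_mono divide_right_mono)
      have "v t \<le> M / (real t + b) ^ (n + 1)" by (rule M)
      also have "\<dots> = M * c ^ (n + 1)" by (simp add: c_def power_one_over)
      also have "\<dots> \<le> max 0 M * c ^ (n + 1)" using c by (intro mult_right_mono) auto
      finally show "v t \<le> max 0 M * c ^ (n + 1)" .
    qed (use c in auto)
    also have "\<dots> = (2 / lam)\<^sup>2 * (1 + max 0 M) * c" using c by (simp add: algebra_simps)
    also have "\<dots> \<le> (2 / lam)\<^sup>2 * (1 + max 0 M) * (1 / (real t + 1))"
      using b by (intro mult_left_mono) (auto simp: c_def intro!: divide_left_mono mult_pos_pos)
    finally show ?thesis by simp
  qed
  show thesis
    by (rule that[of \<alpha> "(2 / lam)\<^sup>2 * (1 + max 0 M)"]) (use \<alpha>(1) rate in auto)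
qed

end

theorem proposition6:
  fixes r :: "'s::finite \<Rightarrow> 'a::finite \<Rightarrow> real"
    and P :: "'s \<Rightarrow> 'a \<Rightarrow> 's pmf"
    and \<mu> :: "'s pmf"
    and \<gamma> lam Rbar :: real
    and \<pi>B \<pi>star :: "'s \<Rightarrow> 'a pmf"
    and \<nu> :: "('s \<times> 'a) pmf"
    and s0 :: 's
  assumes "\<And>s a. \<bar>r s a\<bar> < Rbar"
    and "0 < \<gamma>" and "\<gamma> < 1"
    and "0 < lam"
    and "ergodic_chain (state_action_kernel P \<pi>B)"
    and "stationary_pmf (state_action_kernel P \<pi>B) \<nu>"
    and "\<And>s a. pmf \<nu> (s, a) > 0"
    and "regularized_optimal r P \<gamma> lam \<mu> \<pi>star"
    and "\<pi>star = softmax_policy lam (optimal_soft_Q r P \<gamma> lam)"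
  shows "\<exists>\<alpha> :: nat \<Rightarrow> real. (\<forall>t. 0 < \<alpha> t) \<and>
    (\<lambda>n. measure_pmf.expectation (soft_Q_learning_policy r P \<gamma> lam \<pi>B s0 \<alpha> n)
            (\<lambda>\<pi>o. (policy_dist \<pi>star \<pi>o)\<^sup>2)) \<longlonglongrightarrow> 0 \<and>
    (\<exists>T :: real \<Rightarrow> nat.
       (\<lambda>\<delta>. real (T \<delta>)) \<in> O[at_right 0](\<lambda>\<delta>. ln (1 / \<delta>) / \<delta>\<^sup>2) \<and>
       (\<forall>\<delta>>0. measure_pmf.expectation (soft_Q_learning_policy r P \<gamma> lam \<pi>B s0 \<alpha> (T \<delta>))
                (\<lambda>\<pi>o. (policy_dist \<pi>star \<pi>o)\<^sup>2) \<le> \<delta>\<^sup>2))"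
proof -
  interpret soft_Q_exploration r P \<gamma> lam \<pi>B \<nu> "optimal_soft_Q r P \<gamma> lam"
    using assms soft_bellman_optimal_soft_Q[of \<gamma> lam r P]
    by unfold_locales (auto simp: ergodic_chain_def)
  obtain \<alpha> C where \<alpha>: "\<And>t. 0 < \<alpha> t" and C: "0 \<le> C"
    and rate: "\<And>t. measure_pmf.expectation (soft_Q_learning_policy r P \<gamma> lam \<pi>B s0 \<alpha> t)
          (\<lambda>\<pi>o. (policy_dist \<pi>star \<pi>o)\<^sup>2) \<le> C / (real t + 1)"
    unfolding assms(9)
    by (rule soft_Q_learning_mean_square_rate[of Rbar s0]) (use assms(1) in \<open>auto intro: less_imp_le\<close>)
  let ?err = "\<lambda>t. measure_pmf.expectation (soft_Q_learning_policy r P \<gamma> lam \<pi>B s0 \<alpha> t)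
      (\<lambda>\<pi>o. (policy_dist \<pi>star \<pi>o)\<^sup>2)"

  have "?err \<longlonglongrightarrow> 0"
  proof (rule tendsto_sandwich)
    show "\<forall>\<^sub>F t in sequentially. 0 \<le> ?err t" by simp
    show "\<forall>\<^sub>F t in sequentially. ?err t \<le> C / (real t + 1)" using rate by simp
    show "(\<lambda>t. C / (real t + 1)) \<longlonglongrightarrow> 0"
      using tendsto_mult_right_zero[OF LIMSEQ_inverse_real_of_nat, of C] by (simp add: field_simps)
  qed simp

  define T where "T \<delta> = nat \<lceil>C / \<delta>\<^sup>2\<rceil>" for \<delta> :: real
  have T: "C / \<delta>\<^sup>2 \<le> real (T \<delta>)" "real (T \<delta>) \<le> C / \<delta>\<^sup>2 + 1" for \<delta>
  proof -
    have "0 \<le> C / \<delta>\<^sup>2" using C by simp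
    then show "C / \<delta>\<^sup>2 \<le> real (T \<delta>)" "real (T \<delta>) \<le> C / \<delta>\<^sup>2 + 1"
      unfolding T_def by linarith+
  qed
  have "?err (T \<delta>) \<le> \<delta>\<^sup>2" if "\<delta> > 0" for \<delta>
  proof -
    have "C \<le> \<delta>\<^sup>2 * real (T \<delta>)"
      using T(1)[of \<delta>] that by (simp add: pos_divide_le_eq mult.commute)
    also have "\<dots> \<le> \<delta>\<^sup>2 * (real (T \<delta>) + 1)" by (intro mult_left_mono) auto
    finally have "C / (real (T \<delta>) + 1) \<le> \<delta>\<^sup>2" by (simp add: pos_divide_le_eq)
    then show ?thesis using rate[of "T \<delta>"] by linarith
  qed
  moreover have "(\<lambda>\<delta>. real (T \<delta>)) \<in> O[at_right 0](\<lambda>\<delta>. ln (1 / \<delta>) / \<delta>\<^sup>2)"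
  proof (rule bigoI)
    have "\<forall>\<^sub>F \<delta> in at_right 0. \<delta> < exp (- 1 :: real)"
      using eventually_at_right_real[of 0 "exp (- 1)"] by (auto elim: eventually_mono)
    moreover have "\<forall>\<^sub>F \<delta> in at_right (0::real). 0 < \<delta>" by (rule eventually_at_right_less)
    ultimately show "\<forall>\<^sub>F \<delta> in at_right 0. norm (real (T \<delta>)) \<le> (C + 1) * norm (ln (1 / \<delta>) / \<delta>\<^sup>2)"
    proof eventually_elim
      case (elim \<delta>)
      have "\<delta> < 1" using elim(1) by (rule less_trans) simp
      then have "\<delta>\<^sup>2 \<le> 1" using elim(2) by (simp add: power_le_one)
      then have "1 \<le> 1 / \<delta>\<^sup>2" using elim(2) by simp
      then have "real (T \<delta>) \<le> (C + 1) * (1 / \<delta>\<^sup>2)"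
        using T(2)[of \<delta>] by (simp add: add_divide_distrib)
      moreover have "1 \<le> ln (1 / \<delta>)"
        using elim ln_less_cancel_iff[of \<delta> "exp (- 1)"] by (simp add: ln_div)
      then have "(C + 1) * (1 / \<delta>\<^sup>2) \<le> (C + 1) * (ln (1 / \<delta>) / \<delta>\<^sup>2)"
        using C by (intro mult_left_mono divide_right_mono) auto
      moreover have "norm (ln (1 / \<delta>) / \<delta>\<^sup>2) = ln (1 / \<delta>) / \<delta>\<^sup>2"
        using \<open>1 \<le> ln (1 / \<delta>)\<close> by simp
      ultimately show ?case unfolding real_norm_def abs_of_nat by linarith
    qed
  qed
  ultimately show ?thesis using \<alpha> \<open>?err \<longlonglongrightarrow> 0\<close> by blast
qed

end
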